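(* For all integers $n,h\ge0$, the restriction of $\Phi$ to $\mathcal{D}_{n,h}$ is a bijection from $\mathcal{D}_{n,h}$ onto $\mathcal{B}_{n,h}$.
   Context: Write $[\![j,k]\!]=\{j,\dots,k\}$. Trees: $\mathcal{U}=\{1,2\}^*$ is the set of finite words over $\{1,2\}$ (including the empty word $\emptyset$), $uv$ is concatenation, $uV=\{uv:v\in V\}$. A binary tree is a finite $\mathrm{t}\subset\mathcal{U}$ containing $\emptyset$ and closed under taking prefixes; $v$ is internal if $v1\in\mathrm{t}$ or $v2\in\mathrm{t}$; $\mathrm{t}$ is full if $u1\in\mathrm{t}\iff u2\in\mathrm{t}$ for all $u\in\mathrm{t}$. With $\preceq_{\mathrm{lex}}$ the lexicographic order and $u\wedge v$ the longest common prefix, an embedding of $\mathrm{t}$ in $\mathrm{t}'$ is an injective, $\preceq_{\mathrm{lex}}$-strictly increasing $\varphi:\mathrm{t}\to\mathrm{t}'$ with $\varphi(u\wedge v)=\varphi(u)\wedge\varphi(v)$. Let $\tau_0=\{\emptyset\}$, $\tau_1=\{\emptyset,1,2\}$, $\tau_{2m}=\{\emptyset\}\cup1\tau_m\cup2\tau_{m-1}$, $\tau_{2m+1}=\{\emptyset\}\cup1\tau_m\cup2\tau_m$ ($m\ge1$), and $\mathcal{S}(\mathrm{t})=\max\{r:\tau_r\text{ embeds in }\mathrm{t}\}$. $\mathcal{B}_{n,h}$ is the set of full binary trees with $n$ internal vertices and $\mathcal{S}=h$. Paths: a Dyck path of length $2n$ is $\mathrm{d}:[\![0,2n]\!]\to\mathbb{Z}_{\ge0}$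 with $\mathrm{d}(0)=\mathrm{d}(2n)=0$, $|\mathrm{d}(i)-\mathrm{d}(i-1)|=1$; height $\|\mathrm{d}\|=\max_i\mathrm{d}(i)$; $\mathcal{D}_{n,h}$ is the set of Dyck paths of length $2n$ and height $h$. Decomposition of $\mathrm{d}$ of length $2n$, height $h\ge1$, $m=\lfloor h/2\rfloor$: $\sigma_{\max}=\min\{i:\mathrm{d}(i)=h\}$, $\sigma_g=\max\{i\le\sigma_{\max}:\mathrm{d}(i)=m\}$, $\sigma_d=\min\{i\ge\sigma_{\max}:\mathrm{d}(i)=m\}$, $\sigma_{\mathrm{last}}=\max\{i\ge\sigma_{\max}:\mathrm{d}(i)=m\}$; list $\{i\in[\![\sigma_d,\sigma_{\mathrm{last}}]\!]:\mathrm{d}(i)=m\}$ as $\sigma_d=\rho_1<\dots<\rho_{\ell+1}=\sigma_{\mathrm{last}}$. Dyck paths: $\mathrm{d}^{\mathrm{fix}}(i)=\mathrm{d}(\sigma_g+1+i)-m-1$, $i\in[\![0,\sigma_d-\sigma_g-2]\!]$; $\mathrm{d}^{\mathrm{free}}(i)=\mathrm{d}(i)$ for $i\le\sigma_g$ and $=\mathrm{d}(\sigma_{\mathrm{last}}+i-\sigma_g)$ for $i\in[\![\sigma_g+1,2n-(\sigma_{\mathrm{last}}-\sigma_g)]\!]$; for $j\in[\![1,\ell]\!]$, $\mathrm{d}^{\mathrm{spn}}_j(i)=|\mathrm{d}(\rho_j+1+i)-m|-1$, $i\in[\![0,\rho_{j+1}-\rho_j-2]\!]$; $\epsilon_j=\mathrm{d}(\rho_j+1)-\mathrm{d}(\rho_j)$,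 $u_j=(3+\epsilon_j)/2$, $v_j=(3-\epsilon_j)/2$. The map $\Phi$ from Dyck paths to trees is defined recursively: $\Phi$ of the length-$0$ path is $\{\emptyset\}$; otherwise, if $h$ is even, $\Phi(\mathrm{d})=\{u_1\dots u_j:0\le j\le\ell\}\cup u_1\dots u_\ell1\,\Phi(\mathrm{d}^{\mathrm{free}})\cup u_1\dots u_\ell2\,\Phi(\mathrm{d}^{\mathrm{fix}})\cup\bigcup_{j=1}^\ell u_1\dots u_{j-1}v_j\,\Phi(\mathrm{d}^{\mathrm{spn}}_j)$, and if $h$ is odd the same with $\mathrm{d}^{\mathrm{free}}$ and $\mathrm{d}^{\mathrm{fix}}$ exchanged (i.e. $\Phi(\mathrm{d}^{\mathrm{fix}})$ placed at $u_1\dots u_\ell1$ and $\Phi(\mathrm{d}^{\mathrm{free}})$ at $u_1\dots u_\ell2$). *)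

theory Defs
  imports Main "HOL-Library.Sublist"
begin

text \<open>Words over \<open>{1,2}\<close> are lists of natural numbers. The strict lexicographic order is
  \<^term>\<open>lexord less_than\<close>, in which a proper prefix is smaller.\<close>

abbreviation graft :: "nat list \<Rightarrow> nat list set \<Rightarrow> nat list set" where
  "graft u V \<equiv> (@) u ` V"

definition binary_tree :: "nat list set \<Rightarrow> bool" where
  "binary_tree t \<longleftrightarrow> finite t \<and> t \<subseteq> lists {1, 2} \<and> [] \<in> t \<and>
     (\<forall>v\<in>t. \<forall>u. prefix u v \<longrightarrow> u \<in> t)"

definition internal :: "nat list set \<Rightarrow> nat list set" where
  "internal t = {v \<in> t. v @ [1] \<in> t \<or> v @ [2] \<in> t}"

definition full :: "nat list set \<Rightarrow> bool" where
  "full t \<longleftrightarrow> (\<forall>u\<in>t. u @ [1] \<in> t \<longleftrightarrow> u @ [2] \<in> t)"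

definition embedding :: "(nat list \<Rightarrow> nat list) \<Rightarrow> nat list set \<Rightarrow> nat list set \<Rightarrow> bool" where
  "embedding \<phi> t t' \<longleftrightarrow> \<phi> ` t \<subseteq> t' \<and> inj_on \<phi> t \<and>
     (\<forall>u\<in>t. \<forall>v\<in>t. (u, v) \<in> lexord less_than \<longrightarrow> (\<phi> u, \<phi> v) \<in> lexord less_than) \<and>
     (\<forall>u\<in>t. \<forall>v\<in>t. \<phi> (longest_common_prefix u v) = longest_common_prefix (\<phi> u) (\<phi> v))"

definition embeds :: "nat list set \<Rightarrow> nat list set \<Rightarrow> bool" where
  "embeds t t' \<longleftrightarrow> (\<exists>\<phi>. embedding \<phi> t t')"

fun tau :: "nat \<Rightarrow> nat list set" where
  "tau r =
    (if r = 0 then {[]}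
     else if r = 1 then {[], [1], [2]}
     else if even r then {[]} \<union> graft [1] (tau (r div 2)) \<union> graft [2] (tau (r div 2 - 1))
     else {[]} \<union> graft [1] (tau (r div 2)) \<union> graft [2] (tau (r div 2)))"

declare tau.simps [simp del]

definition S_index :: "nat list set \<Rightarrow> nat" where
  "S_index t = Max {r. embeds (tau r) t}"

definition trees :: "nat \<Rightarrow> nat \<Rightarrow> nat list set set" where
  "trees n h = {t. binary_tree t \<and> full t \<and> card (internal t) = n \<and> S_index t = h}"

text \<open>A path \<open>d\<close> on \<open>{0..N}\<close> is the list of its \<open>N + 1\<close> values \<open>[d(0), ..., d(N)]\<close>, so that
  \<open>d(i)\<close> is \<^term>\<open>d ! i\<close>. Values are integers to avoid truncated subtraction.\<close>

definition dyck_path :: "nat \<Rightarrow> int list \<Rightarrow> bool" where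
  "dyck_path n d \<longleftrightarrow> length d = 2 * n + 1 \<and> (\<forall>i\<le>2 * n. d ! i \<ge> 0) \<and>
     d ! 0 = 0 \<and> d ! (2 * n) = 0 \<and> (\<forall>i\<in>{1..2 * n}. \<bar>d ! i - d ! (i - 1)\<bar> = 1)"

definition height :: "int list \<Rightarrow> int" where
  "height d = Max (set d)"

definition dyck_paths :: "nat \<Rightarrow> nat \<Rightarrow> int list set" where
  "dyck_paths n h = {d. dyck_path n d \<and> height d = int h}"

definition mid :: "int list \<Rightarrow> int" where
  "mid d = height d div 2"

definition sigma_max :: "int list \<Rightarrow> nat" where
  "sigma_max d = Min {i \<in> {..<length d}. d ! i = height d}"

definition sigma_g :: "int list \<Rightarrow> nat" where
  "sigma_g d = Max {i \<in> {..sigma_max d}. d ! i = mid d}"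

definition sigma_d :: "int list \<Rightarrow> nat" where
  "sigma_d d = Min {i \<in> {sigma_max d..<length d}. d ! i = mid d}"

definition sigma_last :: "int list \<Rightarrow> nat" where
  "sigma_last d = Max {i \<in> {sigma_max d..<length d}. d ! i = mid d}"

definition mid_times :: "int list \<Rightarrow> nat set" where
  "mid_times d = {i \<in> {sigma_d d..sigma_last d}. d ! i = mid d}"

definition ell :: "int list \<Rightarrow> nat" where
  "ell d = card (mid_times d) - 1"

text \<open>Indexed from 1: \<open>rho d 1 < ... < rho d (ell d + 1)\<close>.\<close>

definition rho :: "int list \<Rightarrow> nat \<Rightarrow> nat" where
  "rho d j = sorted_list_of_set (mid_times d) ! (j - 1)"

definition d_fix :: "int list \<Rightarrow> int list" where
  "d_fix d = map (\<lambda>i. d ! (sigma_g d + 1 + i) - mid d - 1) [0..<sigma_d d - sigma_g d - 1]"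

definition d_free :: "int list \<Rightarrow> int list" where
  "d_free d = map (\<lambda>i. if i \<le> sigma_g d then d ! i else d ! (sigma_last d + i - sigma_g d))
     [0..<length d - (sigma_last d - sigma_g d)]"

definition d_spn :: "int list \<Rightarrow> nat \<Rightarrow> int list" where
  "d_spn d j = map (\<lambda>i. \<bar>d ! (rho d j + 1 + i) - mid d\<bar> - 1) [0..<rho d (j + 1) - rho d j - 1]"

definition eps :: "int list \<Rightarrow> nat \<Rightarrow> int" where
  "eps d j = d ! (rho d j + 1) - d ! (rho d j)"

definition u_letter :: "int list \<Rightarrow> nat \<Rightarrow> nat" where
  "u_letter d j = nat ((3 + eps d j) div 2)"

definition v_letter :: "int list \<Rightarrow> nat \<Rightarrow> nat" where
  "v_letter d j = nat ((3 - eps d j) div 2)"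

definition u_word :: "int list \<Rightarrow> nat \<Rightarrow> nat list" where
  "u_word d j = map (u_letter d) [1..<j + 1]"

text \<open>\<open>Phi\<close> is only meaningful on Dyck paths (the three kinds of subpaths of a Dyck path are again
  Dyck paths); its value on all other lists is the dummy \<open>{}\<close>, which makes the recursion total.\<close>

function Phi :: "int list \<Rightarrow> nat list set" where
  "Phi d =
    (if \<not> (\<exists>n. dyck_path n d) then {}
     else if length d = 1 then {[]}
     else if even (height d) then
       u_word d ` {0..ell d}
       \<union> graft (u_word d (ell d) @ [1]) (Phi (d_free d))
       \<union> graft (u_word d (ell d) @ [2]) (Phi (d_fix d))
       \<union> (\<Union>j\<in>{1..ell d}. graft (u_word d (j - 1) @ [v_letter d j]) (Phi (d_spn d j)))
     else
       u_word d ` {0..ell d}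
       \<union> graft (u_word d (ell d) @ [1]) (Phi (d_fix d))
       \<union> graft (u_word d (ell d) @ [2]) (Phi (d_free d))
       \<union> (\<Union>j\<in>{1..ell d}. graft (u_word d (j - 1) @ [v_letter d j]) (Phi (d_spn d j))))"
  by pat_completeness auto

lemma dyck_height_pos:
  assumes "dyck_path n d" "length d \<noteq> 1"
  shows "height d \<ge> 1"
proof -
  have n: "n \<ge> 1" and len: "length d = 2 * n + 1" using assms by (auto simp: dyck_path_def)
  have "1 \<in> {1..2 * n}" using n by auto
  hence "\<bar>d ! 1 - d ! (1 - 1)\<bar> = 1" "d ! 1 \<ge> 0" "d ! 0 = 0"
    using assms(1) unfolding dyck_path_def by fastforce+
  hence "d ! 1 = 1" by simp
  moreover have "d ! 1 \<in> set d" using n len by simp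
  ultimately show ?thesis unfolding height_def by (metis List.finite_set Max_ge)
qed

lemma dyck_sigma:
  assumes "dyck_path n d" "length d \<noteq> 1"
  shows "sigma_g d < sigma_max d" "sigma_max d < sigma_d d" "sigma_d d \<le> sigma_last d"
    "sigma_last d < length d"
proof -
  have len: "length d = 2 * n + 1" and ends: "d ! 0 = 0" "d ! (2 * n) = 0"
    using assms(1) unfolding dyck_path_def by auto
  have steps: "\<bar>d ! (i + 1) - d ! i\<bar> = 1" if "i < 2 * n" for i
  proof -
    have "i + 1 \<in> {1..2 * n}" using that by auto
    hence "\<bar>d ! (i + 1) - d ! (i + 1 - 1)\<bar> = 1" using assms(1) unfolding dyck_path_def by blast
    thus ?thesis by simp
  qed
  have h: "height d \<ge> 1" using dyck_height_pos[OF assms] .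
  hence mid: "0 \<le> mid d" "mid d < height d" unfolding mid_def by auto
  let ?M = "{i \<in> {..<length d}. d ! i = height d}"
  have "height d \<in> set d" unfolding height_def using len by (intro Max_in) auto
  hence "?M \<noteq> {}" by (auto simp: in_set_conv_nth)
  hence "sigma_max d \<in> ?M" unfolding sigma_max_def by (intro Min_in) auto
  hence sm: "sigma_max d < length d" "d ! sigma_max d = height d" by auto
  have "\<exists>i\<ge>0. i \<le> sigma_max d \<and> d ! i = mid d"
    by (rule nat_intermed_int_val) (use steps sm len mid ends in auto)
  hence "{i \<in> {..sigma_max d}. d ! i = mid d} \<noteq> {}" by auto
  hence "sigma_g d \<in> {i \<in> {..sigma_max d}. d ! i = mid d}"
    unfolding sigma_g_def by (intro Max_in) auto
  thus "sigma_g d < sigma_max d" using sm mid by (auto simp: le_less)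
  have "\<exists>i\<ge>sigma_max d. i \<le> 2 * n \<and> - (d ! i) = - mid d"
    by (rule nat_intermed_int_val) (use steps sm len mid ends in \<open>auto simp: abs_minus_commute\<close>)
  then obtain i where "sigma_max d \<le> i" "i \<le> 2 * n" "d ! i = mid d" by auto
  hence "i \<in> {i \<in> {sigma_max d..<length d}. d ! i = mid d}" using len by auto
  hence ne: "{i \<in> {sigma_max d..<length d}. d ! i = mid d} \<noteq> {}" by blast
  hence "sigma_d d \<in> {i \<in> {sigma_max d..<length d}. d ! i = mid d}"
    unfolding sigma_d_def by (intro Min_in) auto
  thus "sigma_max d < sigma_d d" using sm mid by (auto simp: le_less)
  have sl: "sigma_last d \<in> {i \<in> {sigma_max d..<length d}. d ! i = mid d}"
    unfolding sigma_last_def using ne by (intro Max_in) auto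
  thus "sigma_last d < length d" by auto
  show "sigma_d d \<le> sigma_last d" unfolding sigma_d_def using sl by (intro Min_le) auto
qed

lemma rho_in_mid_times:
  assumes "j \<in> {1..ell d + 1}" "mid_times d \<noteq> {}"
  shows "rho d j \<in> mid_times d"
proof -
  have fin: "finite (mid_times d)" unfolding mid_times_def by auto
  have "card (mid_times d) > 0" using fin assms(2) by (simp add: card_gt_0_iff)
  hence "j - 1 < card (mid_times d)" using assms(1) unfolding ell_def by auto
  thus ?thesis unfolding rho_def using fin
    by (metis nth_mem length_sorted_list_of_set set_sorted_list_of_set)
qed

lemma subpath_lengths:
  assumes "dyck_path n d" "length d \<noteq> 1"
  shows "length (d_free d) < length d" "length (d_fix d) < length d"
    "j \<in> {1..ell d} \<Longrightarrow> length (d_spn d j) < length d"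
proof -
  note s = dyck_sigma[OF assms]
  show "length (d_free d) < length d" "length (d_fix d) < length d"
    using s by (auto simp: d_free_def d_fix_def)
  assume j: "j \<in> {1..ell d}"
  have "rho d (j + 1) \<in> mid_times d"
    using j by (intro rho_in_mid_times) (auto simp: ell_def)
  thus "length (d_spn d j) < length d" using s by (auto simp: d_spn_def mid_times_def)
qed

termination Phi
  by (relation "measure length") (use subpath_lengths in \<open>simp_all, blast+\<close>)

declare Phi.simps [simp del]

end

theory Submission
  imports Defs
begin

text \<open>
  For a full binary tree with left and right subtrees of indices \<open>a\<close> and \<open>b\<close>, the index is the
  maximum of \<open>a\<close>, \<open>b\<close> and \<open>2 a + 1\<close> (if \<open>a \<le> b\<close>) or \<open>2 b + 2\<close> (if \<open>a > b\<close>). Hence a tree of index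
  \<open>h > 0\<close>, with \<open>m = h div 2\<close>, has a unique descending chain of subtrees of index \<open>h\<close>; the subtrees
  hanging off this chain have index less than \<open>h - m\<close> on the left and less than \<open>m\<close> on the right,
  and the last vertex of the chain carries one subtree of index exactly \<open>h - m - 1\<close> and one of index
  in \<open>[m, h - 1]\<close>, in an order dictated by the parity of \<open>h\<close>. A Dyck path of height \<open>h\<close> is cut
  at level \<open>m\<close> into pieces obeying the very same constraints, and it can be reassembled from them
  because the fixed and spine parts were removed at the last visit of the free part to level \<open>m\<close>.
  The map \<open>\<Phi>\<close> translates one decomposition into the other, so bijectivity follows by induction
  on the size.
\<close>

subsection \<open>Full binary trees and their index\<close>

text \<open>This keeps the simplifier from rewriting the letter \<open>1\<close> to
  \<open>Suc 0\<close> while words over 1 and 2 are manipulated.\<close>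

declare One_nat_def [simp del]

text \<open>Inductive model of full binary trees: index and size become accessible to structural
  induction, and \<open>words\<close> translates back to sets of words.\<close>

datatype btree = Lf | Nd btree btree

fun words :: "btree \<Rightarrow> nat list set" where
  "words Lf = {[]}"
| "words (Nd l r) = insert [] (graft [1] (words l) \<union> graft [2] (words r))"

lemma Nil_in_words [simp]: "[] \<in> words t"
  by (cases t) auto

lemma Cons_in_words [simp]:
  "i # w \<in> words (Nd l r) \<longleftrightarrow> i = 1 \<and> w \<in> words l \<or> i = 2 \<and> w \<in> words r"
  by auto

declare words.simps(2) [simp del]

lemma finite_words: "finite (words t)"
  by (induction t) (auto simp: words.simps)

lemma words_subset_lists: "words t \<subseteq> lists {1, 2}"
proof -
  have "w \<in> words t \<Longrightarrow> set w \<subseteq> {1, 2}" for w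
  proof (induction t arbitrary: w)
    case (Nd l r)
    show ?case using Nd.prems Nd.IH by (cases w) fastforce+
  qed auto
  then show ?thesis by blast
qed

lemma words_prefix_closed: "v \<in> words t \<Longrightarrow> prefix u v \<Longrightarrow> u \<in> words t"
proof (induction t arbitrary: u v)
  case (Nd l r)
  then show ?case by (cases u; cases v) auto
qed auto

lemma binary_tree_words: "binary_tree (words t)"
  unfolding binary_tree_def
  using finite_words words_subset_lists words_prefix_closed by auto

lemma full_words: "full (words t)"
proof -
  have "u \<in> words t \<Longrightarrow> u @ [1] \<in> words t \<longleftrightarrow> u @ [2] \<in> words t" for u
  proof (induction t arbitrary: u)
    case (Nd l r)
    show ?case using Nd.prems by (cases u) (auto simp: Nd.IH)
  qed auto
  then show ?thesis unfolding full_def by blast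
qed

lemma internal_words_Nd:
  "internal (words (Nd l r)) =
    insert [] ((#) 1 ` internal (words l) \<union> (#) 2 ` internal (words r))" (is "?A = ?B")
proof (rule set_eqI)
  fix w show "w \<in> ?A \<longleftrightarrow> w \<in> ?B"
    by (cases w) (auto simp: internal_def)
qed

text \<open>The generated \<open>size\<close> counts the \<open>Nd\<close> constructors and gives 0
  to \<open>Lf\<close>.\<close>

lemma card_internal_words: "card (internal (words t)) = size t"
proof (induction t)
  case Lf
  have "internal (words Lf) = {}" by (auto simp: internal_def)
  then show ?case by simp
next
  case (Nd l r)
  have fin: "finite (internal (words s))" for s
    using finite_words[of s] by (auto simp: internal_def)
  have "card ((#) 1 ` internal (words l) \<union> (#) 2 ` internal (words r)) = size l + size r"
    by (subst card_Un_disjoint) (auto simp: fin card_image Nd)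
  then show ?case
    unfolding internal_words_Nd by (subst card_insert_disjoint) (auto simp: fin)
qed

lemma words_Nd_child:
  "{w. 1 # w \<in> words (Nd l r)} = words l" "{w. 2 # w \<in> words (Nd l r)} = words r"
  by auto

lemma inj_words: "inj words"
proof (rule injI)
  fix s t show "words s = words t \<Longrightarrow> s = t"
  proof (induction s arbitrary: t)
    case Lf
    then have "1 # [] \<notin> words t" by auto
    then show ?case by (cases t) auto
  next
    case (Nd l r)
    have "1 # [] \<in> words t" unfolding Nd.prems[symmetric] by simp
    then obtain l' r' where t: "t = Nd l' r'" by (cases t) auto
    have "words l = words l'" "words r = words r'"
     using arg_cong[OF Nd.prems, of "\<lambda>A. {w. 1 # w \<in> A}"]
        arg_cong[OF Nd.prems, of "\<lambda>A. {w. 2 # w \<in> A}"]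
      by (simp_all only: t words_Nd_child)
    then show ?case using Nd.IH t by blast
  qed
qed

text \<open>Fullness at the root leaves two cases: no child, or both. In the second case the words
  below a child, with the first letter removed, form a full binary tree again; it is smaller since
  the root is lost.\<close>

lemma full_binary_tree_words:
  assumes "binary_tree t" "full t"
  shows "\<exists>s. t = words s"
  using assms
proof (induction "card t" arbitrary: t rule: less_induct)
  case less
  have fin: "finite t" and lists: "t \<subseteq> lists {1, 2}" and Nil: "[] \<in> t"
    and closed: "\<And>u v. v \<in> t \<Longrightarrow> prefix u v \<Longrightarrow> u \<in> t"
    using less.prems(1) unfolding binary_tree_def by blast+
  have twin: "u @ [1] \<in> t \<longleftrightarrow> u @ [2] \<in> t" if "u \<in> t" for u
    using less.prems(2) that unfolding full_def by blast
  have hd: "[i] \<in> t" if "i # w \<in> t" for i w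
    using closed[OF that, of "[i]"] by simp
  have letter: "i = 1 \<or> i = 2" if "i # w \<in> t" for i w
    using subsetD[OF lists that] by simp
  show ?case
  proof (cases "[1] \<in> t")
    case False
    then have "[2] \<notin> t" using twin[OF Nil] by simp
    then have "w = []" if "w \<in> t" for w
      using False hd letter that by (cases w) blast+
    then have "t = words Lf" using Nil by auto
    then show ?thesis by blast
  next
    case True
    then have True2: "[2] \<in> t" using twin[OF Nil] by simp
    have sub: "\<exists>s. {w. i # w \<in> t} = words s" if i: "[i] \<in> t" for i
    proof (rule less.hyps)
      have "(#) i ` {w. i # w \<in> t} \<subset> t" using Nil by blast
      then have "card ((#) i ` {w. i # w \<in> t}) < card t"
        using fin psubset_card_mono by blast
      then show "card {w. i # w \<in> t} < card t" by (simp add: card_image)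
      have "finite ((#) i ` {w. i # w \<in> t})"
        by (rule finite_subset[OF _ fin]) blast
      then have "finite {w. i # w \<in> t}" by (rule finite_imageD) simp
      then show "binary_tree {w. i # w \<in> t}"
        unfolding binary_tree_def
      proof (intro conjI ballI allI impI)
        show "{w. i # w \<in> t} \<subseteq> lists {1, 2}" using lists by fastforce
        fix v u assume "v \<in> {w. i # w \<in> t}" "prefix u v"
        then show "u \<in> {w. i # w \<in> t}" using closed[of "i # v" "i # u"] by simp
      qed (use i in simp_all)
      show "full {w. i # w \<in> t}"
        unfolding full_def using twin[of "i # _"] by simp
    qed
    obtain l r where lr: "{w. 1 # w \<in> t} = words l" "{w. 2 # w \<in> t} = words r"
      using sub True True2 by meson
    have "w \<in> t \<longleftrightarrow> w \<in> words (Nd l r)" for w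
      using Nil letter lr by (cases w) auto
    then show ?thesis by blast
  qed
qed

text \<open>\<open>\<tau>\<^sub>k\<close> embeds in \<open>Nd l r\<close> with the root going to the root iff the two subtrees of
  \<open>\<tau>\<^sub>k\<close>, of indices \<open>k div 2\<close> and \<open>(k - 1) div 2\<close>, embed in \<open>l\<close> and \<open>r\<close>. The last argument of
  \<open>max\<close> below is the largest such \<open>k\<close>.\<close>

fun ht :: "btree \<Rightarrow> nat" where
  "ht Lf = 0"
| "ht (Nd l r) = max (max (ht l) (ht r)) (if ht l \<le> ht r then 2 * ht l + 1 else 2 * ht r + 2)"

text \<open>One recursion covers both parities: for \<open>r = 2 * m\<close> the subtrees have
  indices \<open>m\<close> and \<open>m - 1\<close>, for \<open>r = 2 * m + 1\<close> both have
  index \<open>m\<close>.\<close>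

fun tau_tree :: "nat \<Rightarrow> btree" where
  "tau_tree r = (if r = 0 then Lf else Nd (tau_tree (r div 2)) (tau_tree ((r - 1) div 2)))"

declare tau_tree.simps [simp del]

lemma tau_tree_0 [simp]: "tau_tree 0 = Lf" by (subst tau_tree.simps) simp

lemma words_tau_tree: "words (tau_tree r) = tau r"
proof (induction r rule: less_induct)
  case (less r)
  have "r = 0 \<or> r = 1 \<or> r = 2 * (r div 2) \<and> r div 2 \<ge> 1 \<or> r = 2 * (r div 2) + 1 \<and> r div 2 \<ge> 1"
    by presburger
  then consider "r = 0" | "r = 1" | m where "r = 2 * m" "m \<ge> 1" | m where "r = 2 * m + 1" "m \<ge> 1"
    by blast
  then show ?case
  proof cases
    case (3 m)
    then have [simp]: "(2 * m - 1) div 2 = m - 1" by presburger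
    show ?thesis using 3 less[of m] less[of "m - 1"]
      by (subst tau_tree.simps, subst tau.simps) (auto simp: words.simps)
  next
    case (4 m)
    then show ?thesis using less[of m]
      by (subst tau_tree.simps, subst tau.simps) (auto simp: words.simps)
  qed (simp_all add: tau_tree.simps[of 1] tau.simps words.simps insert_commute)
qed

section \<open>Embeddings between full binary trees\<close>

lemma embeddingD:
  assumes "embedding \<phi> t t'"
  shows "u \<in> t \<Longrightarrow> \<phi> u \<in> t'"
    and "u \<in> t \<Longrightarrow> v \<in> t \<Longrightarrow> \<phi> u = \<phi> v \<longleftrightarrow> u = v"
    and "u \<in> t \<Longrightarrow> v \<in> t \<Longrightarrow> (u, v) \<in> lexord less_than \<Longrightarrow> (\<phi> u, \<phi> v) \<in> lexord less_than"
    and "u \<in> t \<Longrightarrow> v \<in> t \<Longrightarrow>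
      \<phi> (longest_common_prefix u v) = longest_common_prefix (\<phi> u) (\<phi> v)"
  using assms unfolding embedding_def by (blast dest: inj_onD)+

lemma embeddingI:
  assumes "\<And>u. u \<in> t \<Longrightarrow> \<phi> u \<in> t'"
    and "\<And>u v. u \<in> t \<Longrightarrow> v \<in> t \<Longrightarrow> \<phi> u = \<phi> v \<Longrightarrow> u = v"
    and "\<And>u v. u \<in> t \<Longrightarrow> v \<in> t \<Longrightarrow> (u, v) \<in> lexord less_than \<Longrightarrow> (\<phi> u, \<phi> v) \<in> lexord less_than"
    and "\<And>u v. u \<in> t \<Longrightarrow> v \<in> t \<Longrightarrow>
      \<phi> (longest_common_prefix u v) = longest_common_prefix (\<phi> u) (\<phi> v)"
  shows "embedding \<phi> t t'"
  using assms unfolding embedding_def by (blast intro: inj_onI)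

lemma embeds_Lf: "embeds (words Lf) (words t)"
  unfolding embeds_def by (intro exI[of _ "\<lambda>_. []"] embeddingI) auto

lemma not_embeds_Nd_Lf: "\<not> embeds (words (Nd a b)) (words Lf)"
proof
  assume "embeds (words (Nd a b)) (words Lf)"
  then obtain \<phi> where e: "embedding \<phi> (words (Nd a b)) (words Lf)"
    unfolding embeds_def by blast
  have "[] \<in> words (Nd a b)" "1 # [] \<in> words (Nd a b)" by simp_all
  with embeddingD(1,2)[OF e] show False
    by (metis words.simps(1) singletonD list.distinct(1))
qed

lemma embeds_shift:
  assumes "embeds t {w. i # w \<in> t'}"
  shows "embeds t t'"
proof -
  obtain \<phi> where e: "embedding \<phi> t {w. i # w \<in> t'}"
    using assms unfolding embeds_def by blast
  have "embedding (\<lambda>u. i # \<phi> u) t t'"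
    by (rule embeddingI) (use embeddingD[OF e] in auto)
  then show ?thesis unfolding embeds_def by blast
qed

lemma longest_common_prefix_append_same:
  "longest_common_prefix (c @ u) (c @ v) = c @ longest_common_prefix u v"
  by (induction c) auto

text \<open>If everything below \<open>c\<close> is sent below the letter \<open>i\<close>, then
  stripping \<open>c\<close> in the source and \<open>i\<close> in the target leaves an embedding.
  It serves with \<open>c = []\<close> when a whole tree lands in one child, and with
  \<open>c = [1]\<close> and \<open>c = [2]\<close> when the two children are separated.\<close>

lemma embeds_unshift:
  assumes e: "embedding \<phi> t t'"
    and hd: "\<And>u. c @ u \<in> t \<Longrightarrow> \<exists>w. \<phi> (c @ u) = i # w"
  shows "embeds {u. c @ u \<in> t} {w. i # w \<in> t'}"
proof -
  have *: "\<phi> (c @ u) = i # tl (\<phi> (c @ u))" if "c @ u \<in> t" for u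
    using hd[OF that] by auto
  have "embedding (\<lambda>u. tl (\<phi> (c @ u))) {u. c @ u \<in> t} {w. i # w \<in> t'}"
  proof (rule embeddingI)
    fix u assume "u \<in> {u. c @ u \<in> t}"
    then have u: "c @ u \<in> t" by simp
    show "tl (\<phi> (c @ u)) \<in> {w. i # w \<in> t'}"
      using embeddingD(1)[OF e u] *[OF u] by simp
    fix v assume "v \<in> {u. c @ u \<in> t}"
    then have v: "c @ v \<in> t" by simp
    show "tl (\<phi> (c @ u)) = tl (\<phi> (c @ v)) \<Longrightarrow> u = v"
      using embeddingD(2)[OF e u v] *[OF u] *[OF v] by simp
    obtain x y where xy: "\<phi> (c @ u) = i # x" "\<phi> (c @ v) = i # y" using hd u v by blast
    show "tl (\<phi> (c @ longest_common_prefix u v)) =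
        longest_common_prefix (tl (\<phi> (c @ u))) (tl (\<phi> (c @ v)))"
      using embeddingD(4)[OF e u v] xy by (simp add: longest_common_prefix_append_same)
    assume "(u, v) \<in> lexord less_than"
    then have "(c @ u, c @ v) \<in> lexord less_than" by (simp add: lexord_append_leftI)
    then show "(tl (\<phi> (c @ u)), tl (\<phi> (c @ v))) \<in> lexord less_than"
      using embeddingD(3)[OF e u v] xy by simp
  qed
  then show ?thesis unfolding embeds_def by blast
qed

lemma embeds_Nd_NdI:
  assumes "embeds (words a) (words l)" "embeds (words b) (words r)"
  shows "embeds (words (Nd a b)) (words (Nd l r))"
proof -
  obtain \<phi> \<psi> where e: "embedding \<phi> (words a) (words l)" "embedding \<psi> (words b) (words r)"
    using assms unfolding embeds_def by blast
  define \<chi> where "\<chi> w = (case w of [] \<Rightarrow> [] | i # v \<Rightarrow> i # (if i = 1 then \<phi> v else \<psi> v))" for w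
  have \<chi>: "\<chi> [] = []" "\<chi> (1 # v) = 1 # \<phi> v" "\<chi> (2 # v) = 2 # \<psi> v" for v
    by (simp_all add: \<chi>_def)
  have cases: "w = [] \<or> (\<exists>v\<in>words a. w = 1 # v) \<or> (\<exists>v\<in>words b. w = 2 # v)"
    if "w \<in> words (Nd a b)" for w
    using that by (cases w) auto
  have "embedding \<chi> (words (Nd a b)) (words (Nd l r))"
  proof (rule embeddingI)
    fix u assume "u \<in> words (Nd a b)"
    note u = cases[OF this]
    show "\<chi> u \<in> words (Nd l r)"
      using u embeddingD(1)[OF e(1)] embeddingD(1)[OF e(2)] by (auto simp: \<chi>)
    fix v assume "v \<in> words (Nd a b)"
    note v = cases[OF this]
    show "\<chi> u = \<chi> v \<Longrightarrow> u = v"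
      using u v embeddingD(2)[OF e(1)] embeddingD(2)[OF e(2)] by (auto simp: \<chi>)
    show "(u, v) \<in> lexord less_than \<Longrightarrow> (\<chi> u, \<chi> v) \<in> lexord less_than"
      using u v embeddingD(3)[OF e(1)] embeddingD(3)[OF e(2)] by (auto simp: \<chi>)
    show "\<chi> (longest_common_prefix u v) = longest_common_prefix (\<chi> u) (\<chi> v)"
      using u v embeddingD(4)[OF e(1)] embeddingD(4)[OF e(2)] by (auto simp: \<chi>)
  qed
  then show ?thesis unfolding embeds_def by blast
qed

text \<open>Compatibility with longest common prefixes makes the image of the root a prefix of every
  image. If it is nonempty, its first letter names the child that contains the whole image. If it is
  empty, words below 1 and below 2 have images with empty common prefix, hence with different first
  letters, and monotonicity puts them in the right order.\<close>

lemma embeds_Nd_Nd: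
  "embeds (words (Nd a b)) (words (Nd l r)) \<longleftrightarrow>
    embeds (words (Nd a b)) (words l) \<or> embeds (words (Nd a b)) (words r) \<or>
    embeds (words a) (words l) \<and> embeds (words b) (words r)" (is "?L \<longleftrightarrow> ?R")
proof
  assume ?R
  then show ?L
    using embeds_Nd_NdI embeds_shift[where t' = "words (Nd l r)"] words_Nd_child by metis
next
  let ?t = "words (Nd a b)"
  assume ?L
  then obtain \<phi> where e: "embedding \<phi> ?t (words (Nd l r))"
    unfolding embeds_def by blast
  have Nil: "[] \<in> ?t" by simp
  show ?R
  proof (cases "\<phi> []")
    case (Cons i w)
    have "\<exists>w. \<phi> u = i # w" if "u \<in> ?t" for u
      using embeddingD(4)[OF e Nil that] Cons by (cases "\<phi> u") (auto split: if_splits)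
    then have "embeds ?t {w. i # w \<in> words (Nd l r)}"
      using embeds_unshift[OF e, of "[]" i] by simp
    moreover have "i = 1 \<or> i = 2" using embeddingD(1)[OF e Nil] Cons by auto
    ultimately show ?thesis using words_Nd_child by metis
  next
    case Nil\<phi>: Nil
    have hd12: "(\<exists>x. \<phi> (1 # u) = 1 # x) \<and> (\<exists>y. \<phi> (2 # v) = 2 # y)"
      if "1 # u \<in> ?t" "2 # v \<in> ?t" for u v
    proof -
      note t = that
      have "\<phi> (1 # u) \<noteq> []" "\<phi> (2 # v) \<noteq> []"
        using embeddingD(2)[OF e t(1) Nil] embeddingD(2)[OF e t(2) Nil] Nil\<phi> by simp_all
      then obtain i x j y where xy: "\<phi> (1 # u) = i # x" "\<phi> (2 # v) = j # y"
        by (meson neq_Nil_conv)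
      have "i \<noteq> j" using embeddingD(4)[OF e t] xy Nil\<phi> by auto
      moreover have "i \<le> j" using embeddingD(3)[OF e t] xy by auto
      moreover have "i = 1 \<or> i = 2" "j = 1 \<or> j = 2"
        using embeddingD(1)[OF e t(1)] embeddingD(1)[OF e t(2)] xy by auto
      ultimately show ?thesis using xy by auto
    qed
    have "embeds {u. [1] @ u \<in> ?t} {w. 1 # w \<in> words (Nd l r)}"
      by (rule embeds_unshift[OF e]) (use hd12[of _ "[]"] in simp)
    moreover have "embeds {u. [2] @ u \<in> ?t} {w. 2 # w \<in> words (Nd l r)}"
      by (rule embeds_unshift[OF e]) (use hd12[of "[]"] in simp)
    ultimately show ?thesis by (simp add: words_Nd_child)
  qed
qed

text \<open>The indices of the embeddable \<open>tau k\<close> thus form an initial segment, so that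
  the maximum in \<open>S_index\<close> is over a finite nonempty set.\<close>

lemma embeds_tau_words: "embeds (tau k) (words t) \<longleftrightarrow> k \<le> ht t"
proof (induction t arbitrary: k)
  case Lf
  then show ?case
    by (cases "k = 0") (simp_all add: words_tau_tree[symmetric] embeds_Lf
        tau_tree.simps[of k] not_embeds_Nd_Lf del: words.simps)
next
  case (Nd l r)
  show ?case
  proof (cases "k = 0")
    case True
    then show ?thesis by (simp add: words_tau_tree[symmetric] embeds_Lf del: words.simps)
  next
    case False
    then have "embeds (tau k) (words (Nd l r)) \<longleftrightarrow>
        k \<le> ht l \<or> k \<le> ht r \<or> k div 2 \<le> ht l \<and> (k - 1) div 2 \<le> ht r"
      using Nd embeds_Nd_Nd[of "tau_tree (k div 2)" "tau_tree ((k - 1) div 2)" l r]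
      by (metis tau_tree.simps words_tau_tree)
    \<comment> \<open>\<open>k div 2 \<le> a\<close> amounts to \<open>k \<le> 2 * a + 1\<close>,
      and \<open>(k - 1) div 2 \<le> b\<close> to \<open>k \<le> 2 * b + 2\<close>. The smaller of
      the two bounds is the first one exactly when \<open>a \<le> b\<close>.\<close>
    then show ?thesis using False by auto
  qed
qed

lemma S_index_words: "S_index (words t) = ht t"
  unfolding S_index_def embeds_tau_words
  by (rule Max_eqI) (auto simp: finite_Collect_le_nat)

lemma trees_eq: "trees n h = words ` {t. size t = n \<and> ht t = h}"
  unfolding trees_def
proof (intro equalityI subsetI)
  fix x assume "x \<in> {t. binary_tree t \<and> full t \<and> card (internal t) = n \<and> S_index t = h}"
  moreover from this obtain s where "x = words s" using full_binary_tree_words by blast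
  ultimately show "x \<in> words ` {t. size t = n \<and> ht t = h}"
    by (auto simp: card_internal_words S_index_words)
qed (auto simp: binary_tree_words full_words card_internal_words S_index_words)

subsection \<open>The spine of a tree\<close>

text \<open>\<open>F\<close>, \<open>X\<close> and \<open>L\<close> are the free part, the fixed part and the list of spine parts of an
  object of height \<open>h\<close>. A spine part carries the sign \<open>\<epsilon>\<^sub>j\<close>, with \<^term>\<open>True\<close> for \<open>1\<close> and \<^term>\<open>False\<close>
  for \<open>-1\<close>. The same constraints describe trees (\<open>f\<close> is \<^term>\<open>ht\<close>) and Dyck paths (\<open>f\<close> is the height
  of the path).\<close>

definition split_cond :: "('a \<Rightarrow> nat) \<Rightarrow> nat \<Rightarrow> 'a \<Rightarrow> 'a \<Rightarrow> (bool \<times> 'a) list \<Rightarrow> bool" where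
  "split_cond f h F X L \<longleftrightarrow> f X = h - h div 2 - 1 \<and> h div 2 \<le> f F \<and> f F < h \<and>
     (\<forall>(e, s)\<in>set L. f s < (if e then h - h div 2 else h div 2))"

lemma split_cond_Cons:
  "split_cond f h F X ((e, s) # L) \<longleftrightarrow>
     f s < (if e then h - h div 2 else h div 2) \<and> split_cond f h F X L"
  by (auto simp: split_cond_def)

lemma split_cond_cong:
  assumes "f F = g F'" "f X = g X'" "list_all2 (\<lambda>(e, s) (e', s'). e = e' \<and> f s = g s') L L'"
  shows "split_cond f h F X L \<longleftrightarrow> split_cond g h F' X' L'"
  using assms(3)
proof (induction L L' rule: list_all2_induct)
  case Nil
  then show ?case using assms(1,2) by (simp add: split_cond_def)
qed (auto simp: split_cond_Cons)

text \<open>The flag \<open>ev\<close> stands for the parity of the height and orders the free and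
  fixed parts at the end of the spine. For the sign \<open>True\<close> the spine goes right and the
  spine part hangs on the left; for \<open>False\<close> the sides are exchanged.\<close>

fun glue :: "bool \<Rightarrow> btree \<Rightarrow> btree \<Rightarrow> (bool \<times> btree) list \<Rightarrow> btree" where
  "glue ev F X [] = (if ev then Nd F X else Nd X F)"
| "glue ev F X ((e, s) # L) = (if e then Nd s (glue ev F X L) else Nd (glue ev F X L) s)"

text \<open>At the end of the spine the fixed part is the smaller child or tied with the other, and
  produces exactly \<open>h\<close>: \<open>2 * (m - 1) + 2\<close> on the right if
  \<open>h = 2 * m\<close>, and \<open>2 * m + 1\<close> on the left if
  \<open>h = 2 * m + 1\<close>. Higher up, the bounds on the spine parts keep the third term of
  \<open>ht\<close> at most \<open>h\<close>.\<close>

lemma ht_glue: "split_cond ht h F X L \<Longrightarrow> ht (glue (even h) F X L) = h"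
proof (induction L)
  case Nil
  then have *: "ht X = h - h div 2 - 1" "h div 2 \<le> ht F" "ht F < h" by (auto simp: split_cond_def)
  show ?case
  proof (cases "even h")
    case True
    then obtain m where "h = 2 * m" by (elim evenE)
    then show ?thesis using * by (auto simp: max_def)
  next
    case False
    then obtain m where "h = 2 * m + 1" by (elim oddE)
    then show ?thesis using * by (auto simp: max_def)
  qed
next
  case (Cons p L)
  obtain e s where p: "p = (e, s)" by (cases p)
  have "ht (glue (even h) F X L) = h" "ht s < (if e then h - h div 2 else h div 2)"
    using Cons p by (auto simp: split_cond_Cons)
  then show ?case unfolding p by (cases e) (auto simp: max_def)
qed

text \<open>The spine of a tree of height \<open>h\<close> can be read off: it descends into the child of height \<open>h\<close>
  as long as there is one, since the spine and free parts all have height less than \<open>h\<close>.\<close>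

lemma glue_inj:
  assumes "split_cond ht h F X L" "split_cond ht h F' X' L'"
    and "glue (even h) F X L = glue (even h) F' X' L'"
  shows "F = F' \<and> X = X' \<and> L = L'"
  using assms
proof (induction L arbitrary: L')
  case Nil
  have *: "ht X = h - h div 2 - 1" "ht F < h" "ht X' = h - h div 2 - 1" "ht F' < h"
    using Nil by (auto simp: split_cond_def)
  show ?case
  proof (cases L')
    case (Cons p K)
    obtain e s where p: "p = (e, s)" by (cases p)
    have "ht (glue (even h) F' X' K) = h"
      using Nil(2) Cons p by (simp add: split_cond_Cons ht_glue)
    then show ?thesis using Nil(3) * p Cons by (auto split: if_splits)
  qed (use Nil in \<open>auto split: if_splits\<close>)
next
  case (Cons p L)
  have *: "ht X = h - h div 2 - 1" "ht F < h" "ht X' = h - h div 2 - 1" "ht F' < h"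
    using Cons.prems by (auto simp: split_cond_def)
  obtain e s where p: "p = (e, s)" by (cases p)
  have g: "ht (glue (even h) F X L) = h"
    using Cons.prems(1) p by (simp add: split_cond_Cons ht_glue)
  show ?case
  proof (cases L')
    case Nil
    then show ?thesis using Cons.prems(3) * p g by (auto split: if_splits)
  next
    case (Cons p' L'')
    obtain e' s' where p': "p' = (e', s')" by (cases p')
    have g': "ht (glue (even h) F' X' L'') = h"
      using Cons.prems(2) p' Cons by (simp add: split_cond_Cons ht_glue)
    have s: "ht s < (if e then h - h div 2 else h div 2)" "ht s' < (if e' then h - h div 2 else h div 2)"
      using Cons.prems(1,2) p p' Cons by (auto simp: split_cond_Cons)
    then have "ht s < h" "ht s' < h" by (auto split: if_splits)
    then have "e = e' \<and> s = s' \<and> glue (even h) F X L = glue (even h) F' X' L''"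
      using Cons.prems(3) g g' unfolding p p' Cons by (cases e; cases e') auto
    then show ?thesis using Cons.IH[of L''] Cons.prems(1,2) p p' Cons
      by (simp add: split_cond_Cons)
  qed
qed

lemma glue_exists:
  assumes "ht t = h" "h > 0"
  shows "\<exists>F X L. split_cond ht h F X L \<and> t = glue (even h) F X L"
  using assms
proof (induction t)
  case (Nd l r)
  have step: "\<exists>F X L. split_cond ht h F X L \<and> Nd l r = glue (even h) F X L"
    if ss': "(s, s') = (if e then (l, r) else (r, l))" "ht s' = h"
      and s: "ht s < (if e then h - h div 2 else h div 2)" for e s s'
  proof -
    obtain F X L where "split_cond ht h F X L" "s' = glue (even h) F X L"
      using Nd.IH ss' Nd.prems(2) by (cases e) (simp, blast)+
    then have "split_cond ht h F X ((e, s) # L) \<and> Nd l r = glue (even h) F X ((e, s) # L)"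
      using ss' s by (cases e) (auto simp: split_cond_Cons)
    then show ?thesis by blast
  qed
  have base: "\<exists>F X L. split_cond ht h F X L \<and> Nd l r = glue (even h) F X L"
    if "split_cond ht h (if even h then l else r) (if even h then r else l) []"
    using that by (intro exI[of _ "if even h then l else r"] exI[of _ "if even h then r else l"]
        exI[of _ "[]"]) auto
  have h: "max (max (ht l) (ht r)) (if ht l \<le> ht r then 2 * ht l + 1 else 2 * ht r + 2) = h"
    using Nd.prems by simp
  \<comment> \<open>Either a child attains the maximum \<open>h\<close>, and the third term bounds
    the other child; or the third term alone attains it. In the latter case
    \<open>2 * ht l + 1\<close> is odd and makes the left child the fixed part, while
    \<open>2 * ht r + 2\<close> is even and makes the right child the fixed part.\<close>
  have "ht r = h \<and> ht l < h - h div 2 \<or> ht l = h \<and> ht r < h div 2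
    \<or> even h \<and> ht r = h - h div 2 - 1 \<and> h div 2 \<le> ht l \<and> ht l < h
    \<or> odd h \<and> ht l = h - h div 2 - 1 \<and> h div 2 \<le> ht r \<and> ht r < h"
    using h by (auto simp: max_def split: if_splits)
  then consider "ht r = h" "ht l < h - h div 2" | "ht l = h" "ht r < h div 2"
    | "even h" "ht r = h - h div 2 - 1" "h div 2 \<le> ht l" "ht l < h"
    | "odd h" "ht l = h - h div 2 - 1" "h div 2 \<le> ht r" "ht r < h"
    by blast
  then show ?case
  proof cases
    case 1
    then show ?thesis using step[of l r True] by simp
  next
    case 2
    then show ?thesis using step[of r l False] by simp
  qed (rule base, simp add: split_cond_def)+
qed simp

lemma size_glue:
  "size (glue ev F X L) = size F + size X + 1 + (\<Sum>(e, s)\<leftarrow>L. size s + 1)"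
  by (induction L) auto

text \<open>For the sign \<open>e\<close> of a spine part, \<open>up_letter e\<close> is the letter
  \<open>u_j\<close> and \<open>up_letter (\<not> e)\<close> the letter \<open>v_j\<close>.\<close>

definition up_letter :: "bool \<Rightarrow> nat" where
  "up_letter e = (if e then 2 else 1)"

text \<open>The right-hand side has the shape of the recursive equation of \<open>Phi\<close>, with
  the spine parts counted from 0.\<close>

lemma words_glue:
  "words (glue ev F X L) =
     (\<lambda>j. map (up_letter \<circ> fst) (take j L)) ` {..length L}
     \<union> graft (map (up_letter \<circ> fst) L @ [1]) (words (if ev then F else X))
     \<union> graft (map (up_letter \<circ> fst) L @ [2]) (words (if ev then X else F))
     \<union> (\<Union>j<length L. graft (map (up_letter \<circ> fst) (take j L) @ [up_letter (\<not> fst (L ! j))])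
          (words (snd (L ! j))))"
proof (induction L)
  case Nil
  show ?case by (auto simp: words.simps)
next
  case (Cons p L)
  obtain e s where p: "p = (e, s)" by (cases p)
  have graft_Cons: "graft (c # w) V = (#) c ` graft w V" for c :: nat and w V
    by auto
  have "words (glue ev F X (p # L)) =
      insert [] ((#) (up_letter e) ` words (glue ev F X L) \<union> graft [up_letter (\<not> e)] (words s))"
    by (cases e) (auto simp: p words.simps up_letter_def)
  also have "\<dots> = (\<lambda>j. map (up_letter \<circ> fst) (take j (p # L))) ` {..length (p # L)}
     \<union> graft (map (up_letter \<circ> fst) (p # L) @ [1]) (words (if ev then F else X))
     \<union> graft (map (up_letter \<circ> fst) (p # L) @ [2]) (words (if ev then X else F))
     \<union> (\<Union>j<length (p # L). graft (map (up_letter \<circ> fst) (take j (p # L)) @ [up_letter (\<not> fst ((p # L) ! j))])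
          (words (snd ((p # L) ! j))))"
    unfolding Cons.IH
    by (simp add: p atMost_Suc_eq_insert_0 lessThan_Suc_eq_insert_0 image_Un image_UN
        image_image graft_Cons insert_commute Un_assoc Un_left_commute Un_commute)
  finally show ?case .
qed

declare One_nat_def [simp]

subsection \<open>Dyck paths cut at a level\<close>

abbreviation unit_step :: "int \<Rightarrow> int \<Rightarrow> bool" where
  "unit_step x y \<equiv> \<bar>y - x\<bar> = 1"

text \<open>A form of \<open>dyck_path\<close> free of indices and of a prescribed length, suited to
  cutting and appending lists. That the length is odd follows from a parity argument on unit
  steps.\<close>

definition dyck :: "int list \<Rightarrow> bool" where
  "dyck d \<longleftrightarrow> successively unit_step d \<and> d \<noteq> [] \<and> hd d = 0 \<and> last d = 0 \<and> (\<forall>x\<in>set d. 0 \<le> x)"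

lemma unit_walk_parity:
  "successively unit_step d \<Longrightarrow> d \<noteq> [] \<Longrightarrow> even (last d - hd d) \<longleftrightarrow> odd (length d)"
proof (induction d)
  case (Cons x d)
  show ?case
  proof (cases d)
    case (Cons y d')
    then have "even (last d - y) \<longleftrightarrow> odd (length d)" "\<bar>y - x\<bar> = 1"
      using Cons.IH Cons.prems by auto
    moreover from this(2) have "y = x + 1 \<or> y = x - 1" by arith
    ultimately show ?thesis using Cons by auto
  qed simp
qed simp

lemma dyck_path_iff: "dyck_path n d \<longleftrightarrow> dyck d \<and> length d = 2 * n + 1"
proof (cases "length d = 2 * n + 1")
  case True
  then have ne: "d \<noteq> []" by auto
  have "(\<forall>i\<in>{1..2 * n}. \<bar>d ! i - d ! (i - 1)\<bar> = 1) \<longleftrightarrow> (\<forall>i. Suc i < length d \<longrightarrow> unit_step (d ! i) (d ! Suc i))"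
  proof (intro iffI allI ballI impI)
    fix i assume *: "\<forall>i\<in>{1..2 * n}. \<bar>d ! i - d ! (i - 1)\<bar> = 1" "Suc i < length d"
    then have "Suc i \<in> {1..2 * n}" using True by auto
    with *(1) show "unit_step (d ! i) (d ! Suc i)" by fastforce
  next
    fix i assume *: "\<forall>i. Suc i < length d \<longrightarrow> unit_step (d ! i) (d ! Suc i)" "i \<in> {1..2 * n}"
    then obtain j where "i = Suc j" "Suc j < length d" using True by (cases i) auto
    with *(1) show "\<bar>d ! i - d ! (i - 1)\<bar> = 1" by simp
  qed
  moreover have "(\<forall>i\<le>2 * n. d ! i \<ge> 0) \<longleftrightarrow> (\<forall>x\<in>set d. 0 \<le> x)"
    unfolding all_set_conv_all_nth using True by (simp add: less_Suc_eq_le flip: Suc_eq_plus1)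
  ultimately show ?thesis
    using True ne by (auto simp: dyck_path_def dyck_def successively_conv_nth hd_conv_nth last_conv_nth)
qed (simp add: dyck_path_def)

lemma dyck_length:
  assumes "dyck d"
  obtains n where "length d = 2 * n + 1"
proof -
  have "odd (length d)" using assms unit_walk_parity[of d] by (auto simp: dyck_def)
  then show ?thesis using that by (elim oddE)
qed

lemma ex_dyck_path_iff: "(\<exists>n. dyck_path n d) \<longleftrightarrow> dyck d"
  using dyck_length by (auto simp: dyck_path_iff)

lemma dyck_0: "dyck [0]"
  by (simp add: dyck_def)

lemma dyck_length_1: "dyck d \<Longrightarrow> length d = 1 \<longleftrightarrow> d = [0]"
  by (cases d) (auto simp: dyck_def)

section \<open>Heights of Dyck paths\<close>

definition hgt :: "int list \<Rightarrow> nat" where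
  "hgt d = nat (height d)"

lemma dyck_height:
  assumes "dyck d"
  shows "height d = int (hgt d)" "x \<in> set d \<Longrightarrow> 0 \<le> x \<and> x \<le> int (hgt d)" "int (hgt d) \<in> set d"
proof -
  have "height d \<in> set d" "\<And>x. x \<in> set d \<Longrightarrow> x \<le> height d"
    using assms by (auto simp: height_def dyck_def)
  moreover have "\<And>x. x \<in> set d \<Longrightarrow> 0 \<le> x" using assms by (simp add: dyck_def)
  ultimately show "height d = int (hgt d)" "x \<in> set d \<Longrightarrow> 0 \<le> x \<and> x \<le> int (hgt d)"
      "int (hgt d) \<in> set d"
    unfolding hgt_def by auto
qed

lemma hgt_eqI:
  assumes "int h \<in> set d" "\<And>x. x \<in> set d \<Longrightarrow> x \<le> int h"
  shows "hgt d = h"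
proof -
  have "height d = int h" unfolding height_def using assms by (intro Max_eqI) auto
  then show ?thesis by (simp add: hgt_def)
qed

lemma hgt_less_iff: "dyck d \<Longrightarrow> hgt d < k \<longleftrightarrow> (\<forall>x\<in>set d. x < int k)"
  using dyck_height[of d] by (metis of_nat_less_iff order_le_less_trans)

lemma dyck_hgt_0: "dyck d \<Longrightarrow> hgt d = 0 \<longleftrightarrow> d = [0]"
proof
  assume d: "dyck d" "hgt d = 0"
  then obtain n where "dyck_path n d" using ex_dyck_path_iff by blast
  then show "d = [0]" using dyck_height_pos[of n d] dyck_length_1 dyck_height(1) d by fastforce
qed (simp add: hgt_def height_def)

text \<open>Discrete intermediate value theorem: a unit step cannot jump over
  \<open>m\<close>.\<close>

lemma unit_walk_avoiding:
  fixes m :: int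
  assumes "successively unit_step w" "m \<notin> set w"
  shows "(\<forall>x\<in>set w. m < x) \<or> (\<forall>x\<in>set w. x < m)"
  using assms
proof (induction w)
  case (Cons x w)
  then show ?case by (cases w) auto
qed simp

text \<open>An excursion away from level \<open>m\<close>, without the visits to \<open>m\<close> at
  its two ends: the Dyck path \<open>s\<close> is raised above \<open>m\<close>, or reflected below
  it.\<close>

definition block :: "int \<Rightarrow> bool \<Rightarrow> int list \<Rightarrow> int list" where
  "block m e s = map (\<lambda>x. if e then m + 1 + x else m - 1 - x) s"

fun spine :: "int \<Rightarrow> (bool \<times> int list) list \<Rightarrow> int list" where
  "spine m [] = [m]"
| "spine m ((e, s) # L) = m # block m e s @ spine m L"

text \<open>The free part is \<^term>\<open>P @ m # Q\<close>; the fixed and spine parts are inserted at its last visit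
  to level \<open>m\<close>.\<close>

definition join :: "int \<Rightarrow> int list \<Rightarrow> int list \<Rightarrow> int list \<Rightarrow> (bool \<times> int list) list \<Rightarrow> int list" where
  "join m P Q X L = P @ m # block m True X @ spine m L @ Q"

lemma length_block [simp]: "length (block m e s) = length s"
  by (simp add: block_def)

lemma block_eq_Nil [simp]: "block m e s = [] \<longleftrightarrow> s = []"
  by (simp add: block_def)

lemma set_block: "set (block m e s) = (\<lambda>x. if e then m + 1 + x else m - 1 - x) ` set s"
  by (simp add: block_def)

lemma block_walk:
  assumes "dyck s"
  shows "successively unit_step (block m e s)" "s \<noteq> []"
    "hd (block m e s) = (if e then m + 1 else m - 1)" "last (block m e s) = (if e then m + 1 else m - 1)"
proof -
  have "unit_step (if e then m + 1 + x else m - 1 - x) (if e then m + 1 + y else m - 1 - y) \<longleftrightarrow> unit_step x y"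
    for x y by (auto simp: abs_minus_commute)
  then show "successively unit_step (block m e s)"
    using assms by (simp add: block_def successively_map dyck_def)
qed (use assms in \<open>auto simp: dyck_def block_def hd_map last_map\<close>)

lemma not_in_block: "dyck s \<Longrightarrow> m \<notin> set (block m e s)"
  by (force simp: set_block dyck_def)

lemma spine_ne [simp]: "spine m L \<noteq> []"
  by (induction m L rule: spine.induct) auto

lemma hd_spine [simp]: "hd (spine m L) = m"
  by (induction m L rule: spine.induct) auto

lemma last_spine [simp]: "last (spine m L) = m"
  by (induction m L rule: spine.induct) auto

lemma spine_walk: "\<forall>(e, s)\<in>set L. dyck s \<Longrightarrow> successively unit_step (spine m L)"
proof (induction L)
  case (Cons p L)
  obtain e s where p: "p = (e, s)" by (cases p)
  then have "dyck s" using Cons.prems by simp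
  from block_walk[OF this] show ?case
    using Cons p by (auto simp: successively_append_iff successively_Cons)
qed simp

lemma set_spine: "set (spine m L) = insert m (\<Union>(e, s)\<in>set L. set (block m e s))"
  by (induction m L rule: spine.induct) auto

text \<open>Cut at the first return to \<open>m\<close>. The excursion before it avoids
  \<open>m\<close>, so it stays on one side and is a block; the walk from that return on is shorter
  and is handled by induction.\<close>

lemma spine_exists:
  assumes "successively unit_step w" "w \<noteq> []" "hd w = m" "last w = m"
  shows "\<exists>L. w = spine m L \<and> (\<forall>(e, s)\<in>set L. dyck s)"
  using assms
proof (induction "length w" arbitrary: w rule: less_induct)
  case less
  obtain v where w: "w = m # v" using less.prems by (cases w) auto
  show ?case
  proof (cases "v = []")
    case True
    then have "w = spine m []" using w by simp
    then show ?thesis by (intro exI[of _ "[]"]) simp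
  next
    case False
    then have "m \<in> set v" using less.prems(4) w last_in_set[of v] by simp
    then obtain B v' where v: "v = B @ m # v'" "m \<notin> set B" by (blast dest: split_list_first)
    have B: "B \<noteq> []"
    proof
      assume "B = []"
      then show False using less.prems(1) w v by simp
    qed
    have walkB: "successively unit_step B" "unit_step m (hd B)" "unit_step (last B) m"
      "successively unit_step (m # v')"
      using less.prems(1) B unfolding w v by (auto simp: successively_append_iff successively_Cons)
    obtain L where L: "m # v' = spine m L" "\<forall>(e, s)\<in>set L. dyck s"
      using less.hyps[of "m # v'"] walkB(4) less.prems(4) w v by auto
    have B_in: "hd B \<in> set B" "last B \<in> set B" using B by auto
    have "\<exists>e s. B = block m e s \<and> dyck s"
      using unit_walk_avoiding[OF walkB(1) v(2)]
    proof
      assume pos: "\<forall>x\<in>set B. m < x"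
      have "B = block m True (map (\<lambda>x. x - m - 1) B)"
        by (simp add: block_def comp_def)
      moreover have "hd B = m + 1" "last B = m + 1"
        using walkB(2,3) bspec[OF pos B_in(1)] bspec[OF pos B_in(2)] by arith+
      then have "dyck (map (\<lambda>x. x - m - 1) B)"
        unfolding dyck_def using walkB(1) B pos
        by (auto simp: successively_map hd_map last_map)
      ultimately show ?thesis by blast
    next
      assume neg: "\<forall>x\<in>set B. x < m"
      have "B = block m False (map (\<lambda>x. m - 1 - x) B)"
        by (simp add: block_def comp_def)
      moreover have "hd B = m - 1" "last B = m - 1"
        using walkB(2,3) bspec[OF neg B_in(1)] bspec[OF neg B_in(2)] by arith+
      then have "dyck (map (\<lambda>x. m - 1 - x) B)"
        unfolding dyck_def using walkB(1) B neg
        by (auto simp: successively_map hd_map last_map abs_minus_commute)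
      ultimately show ?thesis by blast
    qed
    then obtain e s where es: "B = block m e s" "dyck s" by blast
    then have "w = spine m ((e, s) # L)" using w v L by simp
    then show ?thesis using es L by (intro exI[of _ "(e, s) # L"]) auto
  qed
qed

text \<open>Index in \<^term>\<open>spine m L\<close> of the visit to level \<open>m\<close> preceding the \<open>k\<close>-th block, counted from 0.\<close>

definition pos :: "(bool \<times> int list) list \<Rightarrow> nat \<Rightarrow> nat" where
  "pos L k = (\<Sum>(e, s)\<leftarrow>take k L. Suc (length s))"

lemma pos_0 [simp]: "pos L 0 = 0"
  by (simp add: pos_def)

lemma pos_Cons_Suc [simp]: "pos ((e, s) # L) (Suc k) = Suc (length s + pos L k)"
  by (simp add: pos_def)

lemma pos_Suc: "k < length L \<Longrightarrow> pos L (Suc k) = Suc (pos L k + length (snd (L ! k)))"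
  by (simp add: pos_def take_Suc_conv_app_nth case_prod_beta)

lemma pos_less: "j < k \<Longrightarrow> k \<le> length L \<Longrightarrow> pos L j < pos L k"
proof (induction k)
  case (Suc k)
  then show ?case using pos_Suc[of k L] by (cases "j = k") auto
qed simp

lemma length_spine: "length (spine m L) = Suc (pos L (length L))"
  by (induction m L rule: spine.induct) auto

lemma spine_nth_block:
  "k < length L \<Longrightarrow> i < length (snd (L ! k)) \<Longrightarrow>
    spine m L ! Suc (pos L k + i) = block m (fst (L ! k)) (snd (L ! k)) ! i"
proof (induction m L arbitrary: k rule: spine.induct)
  case (2 m e s L)
  show ?case
  proof (cases k)
    case 0
    then show ?thesis using 2 by (simp add: nth_append)
  next
    case (Suc j)
    then show ?thesis using 2 by (simp add: nth_append add.assoc flip: add_Suc_right)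
  qed
qed simp

text \<open>Blocks avoid level \<open>m\<close>, so it is visited only at the separators.\<close>

lemma spine_nth_eq_mid:
  assumes "\<forall>(e, s)\<in>set L. dyck s"
  shows "{j. j < length (spine m L) \<and> spine m L ! j = m} = pos L ` {..length L}"
  using assms
proof (induction m L rule: spine.induct)
  case (2 m e s L)
  have "m \<notin> set (block m e s)" using 2 not_in_block by auto
  then have b: "block m e s ! i \<noteq> m" if "i < length s" for i
    using that by (metis nth_mem length_block)
  have "j < length (spine m ((e, s) # L)) \<and> spine m ((e, s) # L) ! j = m \<longleftrightarrow>
      j = 0 \<or> (\<exists>k. j = Suc (length s + k) \<and> k < length (spine m L) \<and> spine m L ! k = m)" for j
  proof -
    consider "j = 0" | i where "j = Suc i" "i < length s" | k where "j = Suc (length s + k)"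
      by (cases j) (blast, metis le_iff_add linorder_not_le)
    then show ?thesis
      by cases (auto simp: nth_append b)
  qed
  then have "{j. j < length (spine m ((e, s) # L)) \<and> spine m ((e, s) # L) ! j = m} =
      insert 0 ((\<lambda>k. Suc (length s + k)) ` {k. k < length (spine m L) \<and> spine m L ! k = m})"
    by blast
  moreover have "pos ((e, s) # L) ` {..length ((e, s) # L)} = insert 0 ((\<lambda>k. Suc (length s + k)) ` pos L ` {..length L})"
    by (simp add: atMost_Suc_eq_insert_0 image_image)
  moreover have "{k. k < length (spine m L) \<and> spine m L ! k = m} = pos L ` {..length L}"
    using 2 by simp
  ultimately show ?case by simp
qed auto

text \<open>The admissible pieces of a path of height \<open>h\<close>. Since \<open>Q\<close>
  avoids the level, the free part determines \<open>P\<close> and \<open>Q\<close>, and the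
  insertion point is the last visit.\<close>

definition decomp :: "nat \<Rightarrow> int list \<Rightarrow> int list \<Rightarrow> int list \<Rightarrow> (bool \<times> int list) list \<Rightarrow> bool" where
  "decomp h P Q X L \<longleftrightarrow> dyck (P @ int (h div 2) # Q) \<and> int (h div 2) \<notin> set Q \<and> dyck X \<and>
     (\<forall>(e, s)\<in>set L. dyck s) \<and> split_cond hgt h (P @ int (h div 2) # Q) X L"

section \<open>Assembling a Dyck path from admissible pieces\<close>

context
  fixes h m P Q X L d
  assumes dec: "decomp h P Q X L"
  defines "m \<equiv> int (h div 2)"
  defines "d \<equiv> join m P Q X L"
begin

lemma decompD:
  "dyck (P @ m # Q)" "m \<notin> set Q" "dyck X" "(e, s) \<in> set L \<Longrightarrow> dyck s"
  "hgt X = h - h div 2 - 1" "h div 2 \<le> hgt (P @ m # Q)" "hgt (P @ m # Q) < h"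
  "(e, s) \<in> set L \<Longrightarrow> hgt s < (if e then h - h div 2 else h div 2)"
  using dec unfolding decomp_def split_cond_def m_def by auto

lemma decomp_mid: "0 \<le> m" "m < int h"
  using decompD(7) unfolding m_def by auto

lemma join_set_P: "x \<in> set P \<Longrightarrow> 0 \<le> x \<and> x < int h"
  using dyck_height(2)[OF decompD(1), of x] decompD(7) by auto

text \<open>\<open>Q\<close> avoids \<open>m\<close> and, if nonempty, ends at 0, which is not above
  \<open>m\<close>.\<close>

lemma join_set_Q: "x \<in> set Q \<Longrightarrow> 0 \<le> x \<and> x < m"
proof -
  assume x: "x \<in> set Q"
  have "successively unit_step Q" "last Q = 0"
    using decompD(1) x by (auto simp: dyck_def successively_append_iff successively_Cons split: if_splits)
  moreover have "last Q \<in> set Q" using x by (intro last_in_set) auto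
  ultimately have "x < m"
    using unit_walk_avoiding[of Q m] decompD(2) decomp_mid(1) x by force
  then show ?thesis using decompD(1) x by (auto simp: dyck_def)
qed

lemma join_set_X: "x \<in> set (block m True X) \<Longrightarrow> m < x \<and> x \<le> int h"
proof -
  assume "x \<in> set (block m True X)"
  then obtain y where "y \<in> set X" "x = m + 1 + y" by (auto simp: set_block)
  then show ?thesis
    using dyck_height(2)[OF decompD(3), of y] decompD(5,7) unfolding m_def by auto
qed

lemma height_in_X: "int h \<in> set (block m True X)"
proof -
  have "int (hgt X) \<in> set X" using dyck_height(3) decompD(3) by blast
  moreover have "m + 1 + int (hgt X) = int h"
    using decompD(5,7) unfolding m_def by auto
  ultimately show ?thesis unfolding set_block by (metis (full_types) imageI)
qed

lemma join_set_spine: "x \<in> set (spine m L) \<Longrightarrow> 0 \<le> x \<and> x \<le> int h"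
proof -
  assume "x \<in> set (spine m L)"
  then consider "x = m" | e s y where "(e, s) \<in> set L" "y \<in> set s" "x = (if e then m + 1 + y else m - 1 - y)"
    unfolding set_spine set_block by blast
  then show ?thesis
  proof cases
    case 1
    then show ?thesis using decomp_mid by simp
  next
    case (2 e s y)
    have "0 \<le> y \<and> y \<le> int (hgt s)" using dyck_height(2) decompD(4) 2 by blast
    \<comment> \<open>The height bound for the sign \<open>True\<close> yields
      \<open>m + 1 + y \<le> h\<close>, and the one for \<open>False\<close> yields
      \<open>0 \<le> m - 1 - y\<close>.\<close>
    then show ?thesis using decompD(8)[OF 2(1)] 2(3) unfolding m_def by (auto split: if_splits)
  qed
qed

lemma d_split: "d = P @ m # block m True X @ spine m L @ Q"
  by (simp add: d_def join_def)

lemma set_join: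
  assumes "x \<in> set d"
  shows "0 \<le> x \<and> x \<le> int h"
proof -
  consider "x \<in> set P" | "x = m" | "x \<in> set (block m True X)" | "x \<in> set (spine m L)" | "x \<in> set Q"
    using assms unfolding d_split by auto
  then show ?thesis
    using join_set_P[of x] join_set_Q[of x] join_set_X[of x] join_set_spine[of x] decomp_mid
    by cases linarith+
qed

lemma dyck_join: "dyck d"
  unfolding dyck_def
proof (intro conjI ballI)
  have "successively unit_step (P @ [m])" "successively unit_step (m # Q)"
    using decompD(1) by (auto simp: dyck_def successively_append_iff successively_Cons)
  moreover note block_walk[OF decompD(3)]
  moreover have "successively unit_step (spine m L)" using spine_walk decompD(4) by blast
  ultimately show "successively unit_step d"
    unfolding d_split by (auto simp: successively_append_iff successively_Cons)
  show "d \<noteq> []" by (simp add: d_split)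
  show "hd d = 0" using decompD(1) unfolding d_split by (cases P) (auto simp: dyck_def)
  show "last d = 0" using decompD(1) unfolding d_split by (auto simp: dyck_def last_append)
  fix x assume "x \<in> set d"
  then show "0 \<le> x"
    using set_join[of x] by simp
qed

lemma hgt_join: "hgt d = h"
proof (rule hgt_eqI)
  show "int h \<in> set d" unfolding d_split using height_in_X by simp
  fix x assume "x \<in> set d"
  then show "x \<le> int h"
    using set_join[of x] by simp
qed

lemma height_join: "height d = int h"
  using dyck_height(1)[OF dyck_join] hgt_join by simp

lemma mid_join: "mid d = m"
  by (simp add: mid_def height_join m_def)

lemma length_join: "length d = length (P @ m # Q) + length X + length (spine m L)"
  by (simp add: d_split)

section \<open>Cutting times of the assembled path\<close>

lemma join_nth:
  shows "i < length P \<Longrightarrow> d ! i = P ! i"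
    and "d ! length P = m"
    and "i < length X \<Longrightarrow> d ! Suc (length P + i) = block m True X ! i"
    and "i < length (spine m L) \<Longrightarrow> d ! Suc (length P + length X + i) = spine m L ! i"
    and "d ! Suc (length P + length X + length (spine m L) + i) = Q ! i"
  by (simp_all add: d_split nth_append add.assoc)

text \<open>The free part stays below \<open>h\<close> whereas the block over \<open>X\<close>
  reaches it, so the first maximum lies inside that block.\<close>

lemma sigma_max_join: "length P < sigma_max d" "sigma_max d \<le> length P + length X"
proof -
  let ?M = "{i \<in> {..<length d}. d ! i = height d}"
  obtain k where k: "k < length X" "block m True X ! k = int h"
    using height_in_X by (metis in_set_conv_nth length_block)
  then have M: "Suc (length P + k) \<in> ?M"
    by (simp add: join_nth(3) height_join length_join)
  then have "sigma_max d \<le> Suc (length P + k)"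
    unfolding sigma_max_def by (intro Min_le) auto
  then show "sigma_max d \<le> length P + length X" using k by simp
  have "sigma_max d \<in> ?M"
    unfolding sigma_max_def using M by (intro Min_in) auto
  then have *: "d ! sigma_max d = int h" by (simp add: height_join)
  show "length P < sigma_max d"
  proof (rule ccontr)
    assume "\<not> length P < sigma_max d"
    then consider "sigma_max d < length P" | "sigma_max d = length P" by linarith
    then show False
    proof cases
      case 1
      then show False using * join_nth(1)[OF 1] join_set_P[of "int h"] nth_mem[OF 1] by simp
    next
      case 2
      then show False using * join_nth(2) decomp_mid by simp
    qed
  qed
qed

lemma join_nth_X_ne:
  assumes "length P < i" "i \<le> length P + length X"
  shows "d ! i \<noteq> m"
proof -
  obtain k where k: "i = Suc (length P + k)" "k < length X"
    using assms less_imp_Suc_add by fastforce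
  then have "d ! i \<in> set (block m True X)" using join_nth(3) by simp
  then show ?thesis using join_set_X by fastforce
qed

lemma sigma_g_join: "sigma_g d = length P"
  unfolding sigma_g_def mid_join
proof (rule Max_eqI)
  fix i assume "i \<in> {i \<in> {..sigma_max d}. d ! i = m}"
  then show "i \<le> length P"
    using join_nth_X_ne[of i] sigma_max_join by (cases "i \<le> length P") auto
qed (use sigma_max_join join_nth(2) in auto)

lemma sigma_d_join: "sigma_d d = Suc (length P + length X)"
  unfolding sigma_d_def mid_join
proof (rule Min_eqI)
  fix i assume "i \<in> {i \<in> {sigma_max d..<length d}. d ! i = m}"
  then show "Suc (length P + length X) \<le> i"
    using join_nth_X_ne[of i] sigma_max_join by (cases "i \<le> length P + length X") auto
next
  have "d ! Suc (length P + length X) = m"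
    using join_nth(4)[of 0] by (simp add: hd_conv_nth[symmetric])
  then show "Suc (length P + length X) \<in> {i \<in> {sigma_max d..<length d}. d ! i = m}"
    using sigma_max_join by (simp add: length_join length_spine)
qed auto

text \<open>The spine ends at \<open>m\<close> and the remainder \<open>Q\<close> avoids
  \<open>m\<close>.\<close>

lemma sigma_last_join: "sigma_last d = length P + length X + length (spine m L)"
  unfolding sigma_last_def mid_join
proof (rule Max_eqI)
  fix i assume i: "i \<in> {i \<in> {sigma_max d..<length d}. d ! i = m}"
  show "i \<le> length P + length X + length (spine m L)"
  proof (rule ccontr)
    assume "\<not> ?thesis"
    then obtain k where k: "i = Suc (length P + length X + length (spine m L) + k)"
      using less_imp_Suc_add by fastforce
    then have "k < length Q" using i by (simp add: length_join)
    moreover have "Q ! k = m" using i k join_nth(5) by simp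
    ultimately show False using decompD(2) nth_mem by blast
  qed
next
  have "d ! (length P + length X + length (spine m L)) = m"
    using join_nth(4)[of "pos L (length L)"] last_conv_nth[of "spine m L"] by (simp add: length_spine)
  then show "length P + length X + length (spine m L) \<in> {i \<in> {sigma_max d..<length d}. d ! i = m}"
    using sigma_max_join by (simp add: length_join)
qed auto

lemma mid_times_join: "mid_times d = (\<lambda>k. Suc (length P + length X + pos L k)) ` {..length L}"
proof -
  have "mid_times d = (\<lambda>j. Suc (length P + length X + j)) ` {j. j < length (spine m L) \<and> spine m L ! j = m}"
    (is "?A = ?f ` ?B")
  proof (intro equalityI subsetI)
    fix i assume i: "i \<in> mid_times d"
    then have "Suc (length P + length X) \<le> i" "i \<le> length P + length X + length (spine m L)" "d ! i = m"
      by (auto simp: mid_times_def sigma_d_join sigma_last_join mid_join)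
    moreover from this(1) obtain j where "i = Suc (length P + length X) + j"
      using le_Suc_ex by blast
    ultimately show "i \<in> ?f ` ?B" using join_nth(4)[of j] by auto
  qed (auto simp: mid_times_def sigma_d_join sigma_last_join mid_join join_nth(4))
  also have "\<dots> = ?f ` pos L ` {..length L}"
    by (subst spine_nth_eq_mid) (use decompD(4) in auto)
  finally show ?thesis by (simp add: image_image)
qed

lemma mid_times_join_list:
  "sorted_list_of_set (mid_times d) = map (\<lambda>k. Suc (length P + length X + pos L k)) [0..<Suc (length L)]"
    (is "_ = ?l")
proof -
  have less: "?l ! i < ?l ! j" if "i < j" "j < length ?l" for i j
    using that pos_less[of i j L] by (simp del: upt_Suc)
  then have "sorted_wrt (<) ?l" unfolding sorted_wrt_iff_nth_less by blast
  moreover have "set ?l = mid_times d"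
    unfolding mid_times_join by (simp only: set_map set_upt atLeast0LessThan lessThan_Suc_atMost)
  ultimately show ?thesis
    using sorted_list_of_set.idem_if_sorted_distinct[of ?l] strict_sorted_iff by metis
qed

lemma ell_join: "ell d = length L"
proof -
  have "card (mid_times d) = Suc (length L)"
    using arg_cong[OF mid_times_join_list, of length] by simp
  then show ?thesis by (simp add: ell_def)
qed

text \<open>The times \<open>rho\<close> are counted from 1, the positions \<open>pos\<close> from
  0; the outer \<open>Suc\<close> accounts for the visit to \<open>m\<close> just before the fixed
  part.\<close>

lemma rho_join: "k \<le> length L \<Longrightarrow> rho d (Suc k) = Suc (length P + length X + pos L k)"
  unfolding rho_def mid_times_join_list by (simp del: upt_Suc)

section \<open>Recovering the subpaths and letters\<close>

lemma join_nth_block: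
  assumes "k < length L" "i < length (snd (L ! k))"
  shows "d ! Suc (rho d (Suc k) + i) = block m (fst (L ! k)) (snd (L ! k)) ! i"
proof -
  have "pos L (Suc k) \<le> pos L (length L)"
    using pos_less[of "Suc k" "length L" L] assms(1) by (cases "Suc k = length L") auto
  then have "Suc (pos L k + i) < length (spine m L)"
    using assms pos_Suc[of k L] by (simp add: length_spine)
  from join_nth(4)[OF this] spine_nth_block[OF assms] show ?thesis
    using assms(1) by (simp add: rho_join add.assoc)
qed

lemma dyck_L: "k < length L \<Longrightarrow> dyck (snd (L ! k))"
  using decompD(4) by (metis nth_mem prod.collapse)

lemma d_spn_join:
  assumes k: "k < length L"
  shows "d_spn d (Suc k) = snd (L ! k)"
proof -
  have len: "rho d (Suc k + 1) - rho d (Suc k) - 1 = length (snd (L ! k))"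
    using k rho_join[of k] rho_join[of "Suc k"] pos_Suc[of k L] by simp
  show ?thesis
  proof (rule nth_equalityI)
    fix i assume "i < length (d_spn d (Suc k))"
    then have i: "i < length (snd (L ! k))" using len by (simp add: d_spn_def)
    \<comment> \<open>For a value \<open>x \<ge> 0\<close>, both \<open>1 + x\<close> and
      \<open>- 1 - x\<close> have absolute value \<open>1 + x\<close>, so the formula of
      \<open>d_spn\<close> undoes \<open>block\<close> on either side of the level.\<close>
    have "0 \<le> snd (L ! k) ! i" using dyck_L[OF k] i by (simp add: dyck_def)
    then show "d_spn d (Suc k) ! i = snd (L ! k) ! i"
      using i unfolding d_spn_def len mid_join
      by (simp add: join_nth_block[OF k i]) (simp add: block_def)
  qed (simp only: d_spn_def len length_map length_upt diff_zero)
qed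

lemma eps_join:
  assumes k: "k < length L"
  shows "eps d (Suc k) = (if fst (L ! k) then 1 else - 1)"
proof -
  have ne: "0 < length (snd (L ! k))" and hd: "snd (L ! k) ! 0 = 0"
    using dyck_L[OF k] by (auto simp: dyck_def hd_conv_nth)
  have "rho d (Suc k) \<in> mid_times d"
    unfolding mid_times_join using k by (auto simp: rho_join)
  then have "d ! rho d (Suc k) = m" by (simp add: mid_times_def mid_join)
  then show ?thesis
    using join_nth_block[OF k ne] hd ne by (simp add: eps_def block_def)
qed

lemma u_letter_join: "k < length L \<Longrightarrow> u_letter d (Suc k) = up_letter (fst (L ! k))"
  by (simp add: u_letter_def eps_join up_letter_def)

lemma v_letter_join: "k < length L \<Longrightarrow> v_letter d (Suc k) = up_letter (\<not> fst (L ! k))"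
  by (simp add: v_letter_def eps_join up_letter_def)

lemma u_word_join: "k \<le> length L \<Longrightarrow> u_word d k = map (up_letter \<circ> fst) (take k L)"
  by (rule nth_equalityI) (auto simp: u_word_def u_letter_join simp del: upt_Suc)

lemma d_fix_join: "d_fix d = X"
proof -
  have "d ! (sigma_g d + 1 + i) - mid d - 1 = X ! i" if "i < length X" for i
    using that join_nth(3)[OF that] by (simp add: sigma_g_join mid_join block_def)
  then show ?thesis
    unfolding d_fix_def by (intro nth_equalityI) (simp_all add: sigma_g_join sigma_d_join)
qed

lemma d_free_join: "d_free d = P @ m # Q"
proof (rule nth_equalityI)
  show len: "length (d_free d) = length (P @ m # Q)"
    by (simp add: d_free_def sigma_g_join sigma_last_join length_join length_spine del: upt_Suc)
  fix i assume "i < length (d_free d)"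
  then have i: "d_free d ! i = (if i \<le> length P then d ! i else d ! (sigma_last d + i - length P))"
    "i < length (P @ m # Q)"
    using len by (simp_all add: d_free_def sigma_g_join del: upt_Suc)
  consider "i < length P" | "i = length P" | k where "i = Suc (length P + k)"
    using less_imp_Suc_add[of "length P" i] by (metis linorder_cases)
  then show "d_free d ! i = (P @ m # Q) ! i"
  proof cases
    case (3 k)
    then show ?thesis using i join_nth(5)[of k] by (simp add: sigma_last_join nth_append add_ac)
  qed (use i join_nth in \<open>simp_all add: nth_append\<close>)
qed

text \<open>The pieces that \<open>Phi\<close> extracts from \<open>d\<close> are the ones it was
  assembled from. One unfolding of \<open>Phi\<close> therefore yields the formula for the words of
  a glued tree, with \<open>F\<close>, \<open>T\<close> and \<open>L'\<close> coding the free, fixed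
  and spine parts.\<close>

lemma Phi_join:
  assumes "Phi (P @ m # Q) = words F" "Phi X = words T"
    and L': "list_all2 (\<lambda>(e, s) (e', t). e = e' \<and> Phi s = words t) L L'"
  shows "Phi d = words (glue (even h) F T L')"
proof -
  have len: "length L' = length L" using L' by (simp add: list_all2_lengthD)
  have nth: "fst (L' ! k) = fst (L ! k)" "Phi (snd (L ! k)) = words (snd (L' ! k))" if "k < length L" for k
    using list_all2_nthD[OF L' that] by (auto simp: case_prod_beta)
  have fst: "map (up_letter \<circ> fst) (take k L') = map (up_letter \<circ> fst) (take k L)" for k
    by (rule nth_equalityI) (auto simp: len nth)
  have u: "u_word d ` {0..ell d} = (\<lambda>j. map (up_letter \<circ> fst) (take j L')) ` {..length L'}"
    unfolding ell_join len fst atLeast0AtMost using u_word_join by (intro image_cong) auto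
  have ul: "u_word d (ell d) = map (up_letter \<circ> fst) L'"
    using u_word_join[of "length L"] fst[of "length L"] by (simp add: ell_join len)
  have s: "(\<Union>j\<in>{1..ell d}. graft (u_word d (j - 1) @ [v_letter d j]) (Phi (d_spn d j))) =
    (\<Union>j<length L'. graft (map (up_letter \<circ> fst) (take j L') @ [up_letter (\<not> fst (L' ! j))])
          (words (snd (L' ! j))))" (is "?A = ?B")
  proof -
    \<comment> \<open>The spine index is shifted from counting from 1 to counting from 0.\<close>
    have "?A = (\<Union>k\<in>{..<length L}. graft (u_word d (Suc k - 1) @ [v_letter d (Suc k)]) (Phi (d_spn d (Suc k))))"
      unfolding ell_join image_Suc_lessThan[symmetric] by (simp only: image_image)
    also have "\<dots> = ?B"
      unfolding len by (intro SUP_cong refl) (simp add: u_word_join v_letter_join d_spn_join fst nth)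
    finally show ?thesis .
  qed
  have "length d \<noteq> 1"
    by (simp add: length_join length_spine)
  then have "Phi d = (if even h then
       u_word d ` {0..ell d}
       \<union> graft (u_word d (ell d) @ [1]) (words F)
       \<union> graft (u_word d (ell d) @ [2]) (words T)
       \<union> (\<Union>j\<in>{1..ell d}. graft (u_word d (j - 1) @ [v_letter d j]) (Phi (d_spn d j)))
     else
       u_word d ` {0..ell d}
       \<union> graft (u_word d (ell d) @ [1]) (words T)
       \<union> graft (u_word d (ell d) @ [2]) (words F)
       \<union> (\<Union>j\<in>{1..ell d}. graft (u_word d (j - 1) @ [v_letter d j]) (Phi (d_spn d j))))"
    by (subst Phi.simps) (simp add: ex_dyck_path_iff dyck_join height_join d_free_join d_fix_join assms)
  then show ?thesis
    unfolding words_glue s u ul by simp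
qed

end

subsection \<open>The bijection\<close>

lemma unit_walk_crosses:
  fixes m :: int
  assumes "successively unit_step w" "x \<in> set w" "y \<in> set w" "x \<le> m" "m \<le> y"
  shows "m \<in> set w"
  using unit_walk_avoiding[OF assms(1), of m] assms by force

text \<open>The path is cut at its first visit to \<open>h\<close>, at the last visit to
  \<open>m\<close> before it, and at the first and last visits to \<open>m\<close> after it. The
  stretch around the maximum gives the fixed part, the one between the last two cuts gives the
  spine, and the outer pieces give the free part.\<close>

lemma decomp_exists:
  assumes d: "dyck d" and h: "hgt d = h" "h > 0"
  shows "\<exists>P Q X L. decomp h P Q X L \<and> d = join (int (h div 2)) P Q X L"
proof -
  define m where "m = int (h div 2)"
  have m: "0 \<le> m" "m < int h" using h by (auto simp: m_def)
  have walk: "successively unit_step d" and hd: "hd d = 0" and last: "last d = 0" and "d \<noteq> []"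
    using d by (auto simp: dyck_def)
  have range: "0 \<le> x \<and> x \<le> int h" if "x \<in> set d" for x using dyck_height(2)[OF d that] h by simp
  have "int h \<in> set d" using dyck_height(3)[OF d] h by simp
  then obtain A C where d1: "d = A @ int h # C" "int h \<notin> set A" by (blast dest: split_list_first)
  have "A \<noteq> []" using hd d1 h by auto
  moreover have "C \<noteq> []" using last d1 h by auto
  ultimately have ends: "0 \<in> set A" "0 \<in> set C"
    using hd last d1 hd_in_set[of A] last_in_set[of C] by auto
  have "m \<in> set (A @ [int h])"
    by (rule unit_walk_crosses[of _ 0 "int h"])
      (use walk d1 ends m in \<open>auto simp: successively_append_iff successively_Cons\<close>)
  then have "m \<in> set A" using m by simp
  then obtain P A' where A: "A = P @ m # A'" "m \<notin> set A'" by (blast dest: split_list_last)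
  have "m \<in> set (int h # C)"
    by (rule unit_walk_crosses[of _ 0 "int h"])
      (use walk d1 ends m in \<open>auto simp: successively_append_iff\<close>)
  then have "m \<in> set C" using m by simp
  then obtain C' D where C: "C = C' @ m # D" "m \<notin> set C'" by (blast dest: split_list_first)
  \<comment> \<open>\<open>m # D\<close> starts at the first return to \<open>m\<close> after the
    maximum; its last \<open>m\<close> separates the spine \<open>M @ [m]\<close> from the tail. If
    there is no further visit, \<open>M\<close> is empty and so is the list of spine parts.\<close>
  obtain M Q where D: "m # D = M @ m # Q" "m \<notin> set Q"
    using split_list_last[of m "m # D"] by auto
  define B where "B = A' @ int h # C'"
  have dB: "d = P @ m # B @ (M @ [m]) @ Q"
    using d1 A C D by (simp add: B_def)
  have walks: "successively unit_step (P @ [m])" "successively unit_step B" "unit_step m (hd B)"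
      "unit_step (last B) m" "successively unit_step (M @ [m])" "successively unit_step (m # Q)"
  proof -
    have "B \<noteq> []" by (simp add: B_def)
    moreover have "hd (M @ m # Q) = m" using D(1) by (metis list.sel(1))
    moreover from this have "hd (M @ [m]) = m" by (cases M) auto
    ultimately show "successively unit_step (P @ [m])" "successively unit_step B" "unit_step m (hd B)"
      "unit_step (last B) m" "successively unit_step (M @ [m])" "successively unit_step (m # Q)"
      using walk unfolding dB by (auto simp: successively_append_iff successively_Cons)
  qed
  have hB: "int h \<in> set B" by (simp add: B_def)
  have "m \<notin> set B" using A C m by (auto simp: B_def)
  then have B_gt: "\<forall>x\<in>set B. m < x"
    using unit_walk_avoiding[OF walks(2)] hB m by fastforce
  define X where "X = map (\<lambda>x. x - m - 1) B"
  have BX: "B = block m True X" by (simp add: block_def X_def comp_def)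
  have Bne: "B \<noteq> []" using hB by auto
  have "hd B = m + 1" "last B = m + 1"
    using walks(3,4) B_gt hd_in_set[OF Bne] last_in_set[OF Bne] by force+
  then have dyckX: "dyck X"
    unfolding dyck_def X_def using walks(2) B_gt Bne
    by (auto simp: successively_map hd_map last_map)
  have "hgt X = h - h div 2 - 1"
  proof (rule hgt_eqI)
    have *: "int (h - h div 2 - 1) = int h - m - 1" using h(2) by (simp add: m_def of_nat_diff)
    show "int (h - h div 2 - 1) \<in> set X" unfolding * X_def using hB by simp
    fix x assume "x \<in> set X"
    then obtain b where "b \<in> set B" "x = b - m - 1" unfolding X_def by auto
    then show "x \<le> int (h - h div 2 - 1)" unfolding * using range[of b] dB by simp
  qed
  moreover have "hd (M @ [m]) = m" using D(1) by (cases M) auto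
  then obtain L where L: "M @ [m] = spine m L" "\<forall>(e, s)\<in>set L. dyck s"
    using spine_exists[OF walks(5)] by auto
  moreover have "hgt s < (if e then h - h div 2 else h div 2)" if es: "(e, s) \<in> set L" for e s
  proof -
    have s: "dyck s" using L es by auto
    have "int (hgt s) \<in> set s" using dyck_height(3)[OF s] .
    \<comment> \<open>The extreme value of the block is a value of \<open>d\<close>, hence lies
      between 0 and \<open>h\<close>; this is the required bound on the height of
      \<open>s\<close>.\<close>
    then have "(if e then m + 1 + int (hgt s) else m - 1 - int (hgt s)) \<in> set (spine m L)"
      unfolding set_spine set_block using es by force
    then have "(if e then m + 1 + int (hgt s) else m - 1 - int (hgt s)) \<in> set d"
      unfolding dB L by simp
    from range[OF this] show ?thesis by (auto simp: m_def split: if_splits)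
  qed
  moreover have free: "dyck (P @ m # Q)"
    unfolding dyck_def
  proof (intro conjI ballI)
    show "successively unit_step (P @ m # Q)"
      using walks(1,6) by (auto simp: successively_append_iff successively_Cons)
    show "hd (P @ m # Q) = 0" using hd dB by (cases P) auto
    show "last (P @ m # Q) = 0" using last unfolding dB by (auto simp: last_append split: if_splits)
    fix x assume "x \<in> set (P @ m # Q)"
    then show "0 \<le> x" using range[of x] dB by auto
  qed simp
  moreover have "h div 2 \<le> hgt (P @ m # Q)"
    using dyck_height(2)[OF free, of m] by (simp add: m_def)
  moreover have "hgt (P @ m # Q) < h"
    unfolding hgt_less_iff[OF free]
  proof
    \<comment> \<open>The free part stays below \<open>h\<close> because \<open>Q\<close> is below
      \<open>m\<close> and \<open>P\<close> precedes the first visit to \<open>h\<close>.\<close>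
    have "\<forall>x\<in>set Q. x < m"
    proof (cases "Q = []")
      case False
      then have "last Q = 0" using last dB by simp
      moreover have "last Q \<in> set Q" using False by simp
      moreover have "successively unit_step Q" using walks(6) by (auto simp: successively_Cons)
      ultimately show ?thesis using unit_walk_avoiding[of Q m] D(2) m by fastforce
    qed simp
    moreover have "\<forall>x\<in>set P. x \<noteq> int h \<and> x \<le> int h" using d1 A range dB by auto
    moreover fix x assume "x \<in> set (P @ m # Q)"
    ultimately show "x < int h" using m by fastforce
  qed
  ultimately have "decomp h P Q X L"
    unfolding decomp_def split_cond_def m_def[symmetric] using D(2) dyckX by auto
  moreover have "d = join m P Q X L"
    unfolding join_def dB BX[symmetric] L by simp
  ultimately show ?thesis unfolding m_def by blast
qed

lemma list_all2_choice:
  assumes "\<forall>(e, s)\<in>set L. \<exists>t. R s t"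
  shows "\<exists>L'. list_all2 (\<lambda>(e, s) (e', t). e = e' \<and> R s t) L L'"
  using assms
proof (induction L)
  case (Cons p L)
  obtain e s where p: "p = (e, s)" by (cases p)
  obtain L' t where "list_all2 (\<lambda>(e, s) (e', t). e = e' \<and> R s t) L L'" "R s t"
    using Cons p by auto
  then have "list_all2 (\<lambda>(e, s) (e', t). e = e' \<and> R s t) (p # L) ((e, t) # L')" by (simp add: p)
  then show ?case by blast
qed auto

section \<open>Correspondence between Dyck paths and trees\<close>

lemma Phi_0: "Phi [0] = words Lf"
  using dyck_0 by (subst Phi.simps) (simp add: ex_dyck_path_iff)

text \<open>The graph of \<open>Phi\<close> at the level of \<open>btree\<close>, bundled with
  preservation of size and height so that all three pass through the induction together.\<close>

definition codes :: "int list \<Rightarrow> btree \<Rightarrow> bool" where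
  "codes d t \<longleftrightarrow> dyck d \<and> Phi d = words t \<and> length d = 2 * size t + 1 \<and> ht t = hgt d"

lemma codes_0: "codes [0] Lf"
  using dyck_0 dyck_hgt_0 by (simp add: codes_def Phi_0)

text \<open>Joining paths corresponds to glueing trees. Since coding preserves heights, the
  constraints on the pieces carry over from paths to trees.\<close>

lemma codes_join:
  assumes dec: "decomp h P Q X L"
    and F: "codes (P @ int (h div 2) # Q) F" and T: "codes X T"
    and L: "list_all2 (\<lambda>(e, s) (e', t). e = e' \<and> codes s t) L L'"
  shows "split_cond ht h F T L'" "codes (join (int (h div 2)) P Q X L) (glue (even h) F T L')"
proof -
  have "list_all2 (\<lambda>(e, s) (e', t). e = e' \<and> ht s = hgt t) L' L"
    using L by (auto simp: codes_def list_all2_conv_all_nth case_prod_beta)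
  then show sc: "split_cond ht h F T L'"
    using dec F T split_cond_cong[of ht F hgt "P @ int (h div 2) # Q" T X L' L h]
    by (simp add: codes_def decomp_def)
  \<comment> \<open>A block has odd length \<open>2 * size s + 1\<close>; the visit to the level
    before it adds one, matching the extra internal vertex on the spine. The final visit gives the
    last \<open>1\<close>.\<close>
  have "length (spine (int (h div 2)) L) = 2 * (\<Sum>(e, s)\<leftarrow>L'. size s + 1) + 1"
    using L
  proof (induction L L' rule: list_all2_induct)
    case (Cons p L p' L')
    then show ?case by (cases p; cases p') (simp add: codes_def)
  qed simp
  then have "length (join (int (h div 2)) P Q X L) = 2 * size (glue (even h) F T L') + 1"
    using F T by (simp add: length_join[OF dec] size_glue codes_def)
  moreover have "list_all2 (\<lambda>(e, s) (e', t). e = e' \<and> Phi s = words t) L L'"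
    using L by (rule list_all2_mono) (auto simp: codes_def)
  then have "Phi (join (int (h div 2)) P Q X L) = words (glue (even h) F T L')"
    using Phi_join[OF dec] F T by (simp add: codes_def)
  ultimately show "codes (join (int (h div 2)) P Q X L) (glue (even h) F T L')"
    using ht_glue[OF sc] hgt_join[OF dec] dyck_join[OF dec] by (simp add: codes_def)
qed

lemma length_join_parts:
  assumes "d = join m P Q X L"
  shows "length (P @ m # Q) < length d" "length X < length d"
    "(e, s) \<in> set L \<Longrightarrow> length s < length d"
proof -
  have "(e, s) \<in> set L \<Longrightarrow> length s < length (spine m L)"
    by (induction m L rule: spine.induct) auto
  then show "(e, s) \<in> set L \<Longrightarrow> length s < length d"
    by (simp add: assms join_def)
qed (simp_all add: assms join_def length_spine)

lemma codes_ex_tree: "dyck d \<Longrightarrow> \<exists>t. codes d t"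
proof (induction "length d" arbitrary: d rule: less_induct)
  case less
  show ?case
  proof (cases "d = [0]")
    case False
    then obtain P Q X L where dec: "decomp (hgt d) P Q X L"
      and d: "d = join (int (hgt d div 2)) P Q X L"
      using decomp_exists[OF less.prems refl] dyck_hgt_0[OF less.prems] by auto
    note len = length_join_parts[OF d]
    have dy: "dyck (P @ int (hgt d div 2) # Q)" "dyck X" "\<forall>(e, s)\<in>set L. dyck s"
      using dec by (auto simp: decomp_def)
    obtain F T where "codes (P @ int (hgt d div 2) # Q) F" "codes X T"
      using less.hyps len(1,2) dy(1,2) by meson
    moreover have "\<forall>(e, s)\<in>set L. \<exists>t. codes s t"
      using less.hyps len(3) dy(3) by blast
    then obtain L' where "list_all2 (\<lambda>(e, s) (e', t). e = e' \<and> codes s t) L L'"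
      using list_all2_choice by blast
    ultimately show ?thesis using codes_join(2)[OF dec] d by metis
  qed (use codes_0 in blast)
qed

text \<open>Surjectivity: the tree is split along its spine, its parts are coded by smaller paths,
  and these are joined.\<close>

lemma codes_ex_path: "\<exists>d. codes d t"
proof (induction "size t" arbitrary: t rule: less_induct)
  case less
  show ?case
  proof (cases "t = Lf")
    case False
    define h where "h = ht t"
    have "h > 0" using False by (cases t) (auto simp: h_def max_def)
    then obtain F T L where sc: "split_cond ht h F T L" and t: "t = glue (even h) F T L"
      using glue_exists[OF h_def[symmetric]] by blast
    have "size s < size t" if "(e, s) \<in> set L" for e and s :: btree
    proof -
      have "size s + 1 \<in> set (map (\<lambda>(e, s). size s + 1) L)"
        using that unfolding set_map by (rule rev_image_eqI) simp
      from member_le_sum_list[OF this] show ?thesis by (simp add: t size_glue)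
    qed
    then have "\<forall>(e, s)\<in>set L. \<exists>d. codes d s"
      using less.hyps by (auto simp only: split_paired_all case_prod_conv)
    from list_all2_choice[OF this]
    obtain K where K: "list_all2 (\<lambda>(e, s) (e', d). e = e' \<and> codes d s) L K" by (rule exE)
    then have K': "list_all2 (\<lambda>(e, s) (e', t). e = e' \<and> codes s t) K L"
      by (induction rule: list_all2_induct) auto
    have "size F < size t" "size T < size t" unfolding t size_glue by simp_all
    then obtain f X where fX: "codes f F" "codes X T" using less.hyps[of F] less.hyps[of T] by metis
    have f: "dyck f" "h div 2 \<le> hgt f" using fX sc by (simp_all add: codes_def split_cond_def)
    \<comment> \<open>The path of the free part starts at 0 and reaches height at least
      \<open>h div 2\<close>, so it visits that level; its last visit is the insertion
      point.\<close>
    have "int (h div 2) \<in> set f"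
      by (rule unit_walk_crosses[where x = 0 and y = "int (hgt f)"])
        (use f dyck_height(3)[OF f(1)] hd_in_set[of f] in \<open>auto simp: dyck_def\<close>)
    then obtain P Q where PQ: "f = P @ int (h div 2) # Q" "int (h div 2) \<notin> set Q"
      by (blast dest: split_list_last)
    have "list_all2 (\<lambda>(e, s) (e', t). e = e' \<and> hgt s = ht t) K L"
      using K' by (rule list_all2_mono) (auto simp: codes_def)
    then have "split_cond hgt h f X K"
      using sc fX split_cond_cong[of hgt f ht F X T K L h] by (simp add: codes_def)
    moreover have "\<forall>(e, s)\<in>set K. dyck s"
      using K' by (induction rule: list_all2_induct) (auto simp: codes_def)
    ultimately have "decomp h P Q X K"
      using PQ fX by (simp add: decomp_def codes_def)
    from codes_join(2)[OF this _ fX(2) K'] show ?thesis using fX(1) PQ t by blast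
  qed (use codes_0 in blast)
qed

text \<open>Injectivity: both paths have the height of \<open>t\<close>, so they are cut at the same
  level. The injectivity of \<open>words\<close> and of glueing forces corresponding pieces to code
  the same trees, and by induction the pieces coincide.\<close>

lemma codes_unique: "codes d t \<Longrightarrow> codes d' t \<Longrightarrow> d = d'"
proof (induction "length d" arbitrary: d d' t rule: less_induct)
  case less
  have dy: "dyck d" "dyck d'" and hgt: "hgt d = ht t" "hgt d' = ht t"
    using less.prems by (auto simp: codes_def)
  show ?case
  proof (cases "ht t = 0")
    case True
    then show ?thesis using dyck_hgt_0 dy hgt by auto
  next
    case False
    define h where "h = ht t"
    obtain P Q X L where dec: "decomp h P Q X L" and d: "d = join (int (h div 2)) P Q X L"
      using decomp_exists[OF dy(1), of h] hgt False by (auto simp: h_def)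
    obtain P' Q' X' L' where dec': "decomp h P' Q' X' L'" and d': "d' = join (int (h div 2)) P' Q' X' L'"
      using decomp_exists[OF dy(2), of h] hgt False by (auto simp: h_def)
    have ex: "\<exists>F T K. codes (P @ int (h div 2) # Q) F \<and> codes X T \<and>
        list_all2 (\<lambda>(e, s) (e', t). e = e' \<and> codes s t) L K" if "decomp h P Q X L" for P Q X L
    proof -
      have "\<exists>t. codes (P @ int (h div 2) # Q) t" "\<exists>t. codes X t" "\<forall>(e, s)\<in>set L. \<exists>t. codes s t"
        using that codes_ex_tree by (auto simp: decomp_def)
      then show ?thesis using list_all2_choice[of L codes] by blast
    qed
    obtain F T K where c: "codes (P @ int (h div 2) # Q) F" "codes X T"
      "list_all2 (\<lambda>(e, s) (e', t). e = e' \<and> codes s t) L K" using ex[OF dec] by blast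
    obtain F' T' K' where c': "codes (P' @ int (h div 2) # Q') F'" "codes X' T'"
      "list_all2 (\<lambda>(e, s) (e', t). e = e' \<and> codes s t) L' K'" using ex[OF dec'] by blast
    have "words t = words (glue (even h) F T K)" "words t = words (glue (even h) F' T' K')"
      using codes_join(2)[OF dec c] codes_join(2)[OF dec' c'] less.prems unfolding d d'
      by (simp_all add: codes_def)
    then have "glue (even h) F T K = glue (even h) F' T' K'"
      using inj_words by (simp add: inj_eq)
    then have eq: "F' = F" "T' = T" "K' = K"
      using glue_inj[OF codes_join(1)[OF dec c] codes_join(1)[OF dec' c']] by auto
    note len = length_join_parts[OF d]
    have X: "X' = X" using less.hyps[OF len(2)] c(2) c'(2) eq by blast
    have "P @ int (h div 2) # Q = P' @ int (h div 2) # Q'"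
      using less.hyps[OF len(1)] c(1) c'(1) eq by blast
    moreover have "int (h div 2) \<notin> set Q" "int (h div 2) \<notin> set Q'"
      using dec dec' by (auto simp: decomp_def)
    \<comment> \<open>Both splittings of the common free part are at its last visit to the
      level.\<close>
    ultimately have PQ: "P' = P" "Q' = Q"
      by (auto simp: append_eq_append_conv2 Cons_eq_append_conv append_eq_Cons_conv)
    have "L' = L"
    proof (rule nth_equalityI)
      show length: "length L' = length L"
        using c(3) c'(3) eq by (simp add: list_all2_lengthD)
      fix k assume k: "k < length L'"
      have "fst (L ! k) = fst (K ! k)" "codes (snd (L ! k)) (snd (K ! k))"
        using list_all2_nthD[OF c(3), of k] k length by (auto simp: case_prod_beta)
      moreover have "fst (L' ! k) = fst (K ! k)" "codes (snd (L' ! k)) (snd (K ! k))"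
        using list_all2_nthD[OF c'(3) k] eq by (auto simp: case_prod_beta)
      moreover have "length (snd (L ! k)) < length d"
        using len(3)[of "fst (L ! k)" "snd (L ! k)"] k length by simp
      ultimately have "snd (L ! k) = snd (L' ! k)" "fst (L ! k) = fst (L' ! k)"
        using less.hyps by simp_all
      then show "L' ! k = L ! k" by (simp add: prod_eq_iff)
    qed
    then show ?thesis unfolding d d' X PQ by simp
  qed
qed

theorem theorem3p2:
  fixes n h :: nat
  shows "bij_betw Phi (dyck_paths n h) (trees n h)"
proof (rule bij_betw_imageI)
  have path: "d \<in> dyck_paths n h \<longleftrightarrow> dyck d \<and> length d = 2 * n + 1 \<and> hgt d = h" for d
    using dyck_height(1)[of d] by (auto simp: dyck_paths_def dyck_path_iff)
  show "inj_on Phi (dyck_paths n h)"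
  proof (rule inj_onI)
    fix d d' assume "d \<in> dyck_paths n h" "d' \<in> dyck_paths n h" and eq: "Phi d = Phi d'"
    then obtain t t' where "codes d t" "codes d' t'" using codes_ex_tree path by blast
    moreover from this have "t = t'" using eq inj_words by (simp add: codes_def inj_eq)
    ultimately show "d = d'" using codes_unique by blast
  qed
  show "Phi ` dyck_paths n h = trees n h"
  proof (intro equalityI subsetI)
    fix w assume "w \<in> Phi ` dyck_paths n h"
    then obtain d where d: "d \<in> dyck_paths n h" "w = Phi d" by blast
    then obtain t where "codes d t" using codes_ex_tree path by blast
    then show "w \<in> trees n h" using d path by (auto simp: trees_eq codes_def)
  next
    fix w assume "w \<in> trees n h"
    then obtain t where t: "w = words t" "size t = n" "ht t = h" by (auto simp: trees_eq)
    obtain d where "codes d t" using codes_ex_path by blast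
    then show "w \<in> Phi ` dyck_paths n h" using t path by (auto simp: codes_def)
  qed
qed

end
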